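(* Let $R$ be a finite Frobenius ring with normalized homogeneous weight $\mathrm{w}_{\mathrm{hom}}$, extended additively to $R^n$, and let $C\le {}_RR^n$ be a regular projective two-weight code whose two distinct nonzero $\mathrm{w}_{\mathrm{hom}}$-weights are $w_1$ and $w_2$. Then the graph $\Gamma(C)=(C,E)$ with vertex set $C$ and edge set $E=\bigl\{\{x,y\}\mid x,y\in C,\ \mathrm{w}_{\mathrm{hom}}(x-y)=w_1\bigr\}$ is strongly regular. Its parameters are $(N,K,\lambda,\mu)$, where \begin{align*} N&=|C|,\\ K&=\frac{(n-w_2)|C|+w_2}{w_1-w_2},\\ \lambda&=\frac{nK\left[1-\left(1-\frac{w_1}{n}\right)^2\right]+w_2(1-K)}{w_1-w_2},\\ \mu&=\frac{nK\left[1-\left(1-\frac{w_1}{n}\right)\left(1-\frac{w_2}{n}\right)\right]-w_2K}{w_1-w_2}. \end{align*}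
   Context: Rings are associative with identity. A finite ring $R$ is Frobenius if ${}_R\mathrm{Soc}({}_RR)\cong {}_R(R/\mathrm{Rad}(R))$ (equivalently ${}_RR\cong{}_R\widehat R$, with $\widehat R=\mathrm{Hom}_{\mathbb Z}(R,\mathbb C^\times)$ the character module). A (left) homogeneous weight on a finite ring $R$ is a map $w:R\to\mathbb R$ with $w(0)=0$, $w(x)\ge 0$ for all $x$, such that $w(x)=w(y)$ whenever $Rx=Ry$, and such that there is a real number $\gamma$ (the average value) with $\sum_{y\in Rx}w(y)=\gamma|Rx|$ for all $x\in R\setminus\{0\}$. For each $\gamma\geq 0$ there is exactly one homogeneous weight on $R$ with average value $\gamma$; the one with $\gamma=1$ is called normalized and denoted $\mathrm{w}_{\mathrm{hom}}$. Weights are extended to $R^n$ by $w(c_1,\dots,c_n)=\sum_{i=1}^n w(c_i)$. A left linear code of length $n$ is a submodule $C\le {}_RR^n$. Write $C=\{xY\mid x\in R^k\}$ for a $k\times n$ generator matrix $Y=(y_1|\cdots|y_n)$ over $R$. A point of the Barbilian space of $R^k_R$ is a submodule $yR$ with $y\in R^k$ such that $\varphi(y)=1$ for some $\varphi\in\mathrm{Hom}(R^k_R,R_R)$. The code $C$ is regular if $y_iR$ is such a point for every $i$ (equivalently, every coordinate projection $\pi_i:C\to R$ is surjective); projective if $y_iR\ne y_jR$ for all $i\neq j$ (this does not depend on the choice of $Y$); proper if $\mathrm{w}_{\mathrm{hom}}(c)>0$ for every nonzero $c\in C$. A two-weight code is a proper linear code on which the homogeneous weight takes exactly two nonzero values.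 A simple graph is strongly regular with parameters $(N,K,\lambda,\mu)$ if it has $N$ vertices, is neither empty nor complete, is regular of degree $K$, every two adjacent vertices have exactly $\lambda$ common neighbours, and every two distinct non-adjacent vertices have exactly $\mu$ common neighbours. *)

theory Defs
  imports "HOL-Analysis.Finite_Cartesian_Product" "HOL-Library.Set_Algebras"
begin

section \<open>Finite Frobenius rings\<close>

definition left_ideal :: "'a::ring_1 set \<Rightarrow> bool" where
  "left_ideal I \<longleftrightarrow>
     0 \<in> I \<and> (\<forall>x\<in>I. \<forall>y\<in>I. x + y \<in> I) \<and> (\<forall>r. \<forall>x\<in>I. r * x \<in> I)"

definition minimal_left_ideal :: "'a::ring_1 set \<Rightarrow> bool" where
  "minimal_left_ideal I \<longleftrightarrow>
     left_ideal I \<and> I \<noteq> {0} \<and> (\<forall>J. left_ideal J \<and> J \<subseteq> I \<longrightarrow> J = {0} \<or> J = I)"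

definition maximal_left_ideal :: "'a::ring_1 set \<Rightarrow> bool" where
  "maximal_left_ideal I \<longleftrightarrow>
     left_ideal I \<and> I \<noteq> UNIV \<and> (\<forall>J. left_ideal J \<and> I \<subseteq> J \<longrightarrow> J = I \<or> J = UNIV)"

text \<open>The left socle is the sum of all minimal left ideals, i.e. the smallest left ideal
  containing each of them.\<close>

definition left_socle :: "'a::ring_1 set" where
  "left_socle = left_ideal hull (\<Union>{I. minimal_left_ideal I})"

definition jacobson_radical :: "'a::ring_1 set" where
  "jacobson_radical = \<Inter>{I. maximal_left_ideal I}"

text \<open>Isomorphism of left modules over the ring type \<^typ>\<open>'a\<close>; a module is given by its carrier,
  its addition and its scalar multiplication.\<close>

definition left_module_iso ::
  "'b set \<Rightarrow> ('b \<Rightarrow> 'b \<Rightarrow> 'b) \<Rightarrow> ('a::ring_1 \<Rightarrow> 'b \<Rightarrow> 'b) \<Rightarrow>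
   'c set \<Rightarrow> ('c \<Rightarrow> 'c \<Rightarrow> 'c) \<Rightarrow> ('a \<Rightarrow> 'c \<Rightarrow> 'c) \<Rightarrow> bool" where
  "left_module_iso M addM smulM N addN smulN \<longleftrightarrow>
     (\<exists>f. bij_betw f M N \<and>
          (\<forall>x\<in>M. \<forall>y\<in>M. f (addM x y) = addN (f x) (f y)) \<and>
          (\<forall>r. \<forall>x\<in>M. f (smulM r x) = smulN r (f x)))"

text \<open>The elements of \<open>R/Rad(R)\<close> are the cosets \<open>a + Rad(R)\<close>. The sum of two cosets is
  their elementwise sum. The elementwise multiple \<open>r *o A\<close> of a coset can be smaller than a
  coset, so \<open>Rad(R)\<close> is added to it: \<open>r(a + Rad(R)) + Rad(R) = ra + Rad(R)\<close>.\<close>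

definition frobenius_ring :: "'a::{finite,ring_1} itself \<Rightarrow> bool" where
  "frobenius_ring _ \<longleftrightarrow>
     left_module_iso (left_socle :: 'a set) (+) (*)
       (range (\<lambda>a::'a. a +o jacobson_radical)) (+) (\<lambda>r A. r *o A + jacobson_radical)"

section \<open>Homogeneous weights\<close>

definition left_principal :: "'a::ring_1 \<Rightarrow> 'a set" where
  "left_principal x = range (\<lambda>r. r * x)"

definition homogeneous_weight :: "real \<Rightarrow> ('a::{finite,ring_1} \<Rightarrow> real) \<Rightarrow> bool" where
  "homogeneous_weight \<gamma> w \<longleftrightarrow>
     w 0 = 0 \<and> (\<forall>x. 0 \<le> w x) \<and>
     (\<forall>x y. left_principal x = left_principal y \<longrightarrow> w x = w y) \<and>
     (\<forall>x. x \<noteq> 0 \<longrightarrow> (\<Sum>y\<in>left_principal x. w y) = \<gamma> * real (card (left_principal x)))"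

definition normalized_homogeneous_weight :: "('a::{finite,ring_1} \<Rightarrow> real) \<Rightarrow> bool" where
  "normalized_homogeneous_weight w \<longleftrightarrow> homogeneous_weight 1 w"

definition vec_weight :: "('a \<Rightarrow> real) \<Rightarrow> 'a ^ 'n \<Rightarrow> real" where
  "vec_weight w c = (\<Sum>i\<in>UNIV. w (c $ i))"

section \<open>Linear codes and their generator matrices\<close>

definition left_linear_code :: "('a::ring_1 ^ 'n) set \<Rightarrow> bool" where
  "left_linear_code C \<longleftrightarrow>
     0 \<in> C \<and> (\<forall>x\<in>C. \<forall>y\<in>C. x + y \<in> C) \<and> (\<forall>r. \<forall>x\<in>C. r *s x \<in> C)"

definition generator_matrix :: "'a::ring_1 ^ 'n ^ 'k \<Rightarrow> ('a ^ 'n) set \<Rightarrow> bool" where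
  "generator_matrix Y C \<longleftrightarrow> C = range (\<lambda>x. x v* Y)"

text \<open>The library's \<^term>\<open>r *s x\<close> multiplies by the scalar on the left; the following is the
  scalar multiplication of the right module.\<close>

definition right_scale :: "'a::ring_1 ^ 'k \<Rightarrow> 'a \<Rightarrow> 'a ^ 'k" where
  "right_scale y r = (\<chi> i. y $ i * r)"

definition right_cyclic :: "'a::ring_1 ^ 'k \<Rightarrow> ('a ^ 'k) set" where
  "right_cyclic y = range (right_scale y)"

definition right_linear :: "('a::ring_1 ^ 'k \<Rightarrow> 'a) \<Rightarrow> bool" where
  "right_linear \<phi> \<longleftrightarrow>
     (\<forall>x y. \<phi> (x + y) = \<phi> x + \<phi> y) \<and> (\<forall>x r. \<phi> (right_scale x r) = \<phi> x * r)"

definition barbilian_points :: "('a::ring_1 ^ 'k) set set" where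
  "barbilian_points = {right_cyclic y | y. \<exists>\<phi>. right_linear \<phi> \<and> \<phi> y = 1}"

text \<open>Regularity and projectivity are properties of a code, but are expressed through the columns
  of a generator matrix. The lemmas below show that the choice of the matrix does not matter.\<close>

definition regular_code :: "'a::ring_1 ^ 'n ^ 'k \<Rightarrow> ('a ^ 'n) set \<Rightarrow> bool" where
  "regular_code Y C \<longleftrightarrow>
     generator_matrix Y C \<and> (\<forall>i. right_cyclic (column i Y) \<in> barbilian_points)"

definition projective_code :: "'a::ring_1 ^ 'n ^ 'k \<Rightarrow> ('a ^ 'n) set \<Rightarrow> bool" where
  "projective_code Y C \<longleftrightarrow>
     generator_matrix Y C \<and>
     (\<forall>i j. i \<noteq> j \<longrightarrow> right_cyclic (column i Y) \<noteq> right_cyclic (column j Y))"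

definition proper_code :: "('a::ring_1 \<Rightarrow> real) \<Rightarrow> ('a ^ 'n) set \<Rightarrow> bool" where
  "proper_code w C \<longleftrightarrow> (\<forall>c\<in>C. c \<noteq> 0 \<longrightarrow> vec_weight w c > 0)"

definition two_weight_code ::
  "('a::ring_1 \<Rightarrow> real) \<Rightarrow> ('a ^ 'n) set \<Rightarrow> real \<Rightarrow> real \<Rightarrow> bool" where
  "two_weight_code w C w1 w2 \<longleftrightarrow>
     left_linear_code C \<and> proper_code w C \<and>
     w1 \<noteq> w2 \<and> vec_weight w ` C - {0} = {w1, w2}"

text \<open>Every code has a generator matrix: its rows may be all codewords, indexed by \<open>R\<^sup>n\<close>.\<close>

lemma vector_matrix_mult_nth: "(x v* Y) $ j = (\<Sum>i\<in>UNIV. x $ i * Y $ i $ j)"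
  by (simp add: vector_matrix_mult_def)

lemma axis_vector_matrix_mult:
  fixes Y :: "'a::ring_1 ^ 'n ^ 'k"
  shows "axis l 1 v* Y = Y $ l"
  by (simp add: vec_eq_iff vector_matrix_mult_nth axis_def if_distrib[of "\<lambda>a. a * _"] cong: if_cong)

lemma left_linear_code_has_generator_matrix:
  fixes C :: "('a::{finite,ring_1} ^ 'n) set"
  assumes "left_linear_code C"
  shows "\<exists>Y :: 'a ^ 'n ^ ('a ^ 'n). generator_matrix Y C"
proof -
  define Y :: "'a ^ 'n ^ ('a ^ 'n)" where "Y = (\<chi> v. if v \<in> C then v else 0)"
  have sum_closed: "(\<Sum>i\<in>A. f i) \<in> C" if "finite A" "\<And>i. i \<in> A \<Longrightarrow> f i \<in> C"
    for A and f :: "'a ^ 'n \<Rightarrow> 'a ^ 'n"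
    using that assms by (induction A rule: finite_induct) (auto simp: left_linear_code_def)
  have "x v* Y \<in> C" for x
  proof -
    have "x v* Y = (\<Sum>i\<in>UNIV. x $ i *s Y $ i)"
      by (simp add: vec_eq_iff vector_matrix_mult_nth)
    moreover have "x $ i *s Y $ i \<in> C" for i
      using assms by (auto simp: left_linear_code_def Y_def)
    ultimately show ?thesis
      by (simp add: sum_closed)
  qed
  moreover have "c \<in> range (\<lambda>x. x v* Y)" if "c \<in> C" for c
    using that axis_vector_matrix_mult[of c Y, symmetric]
    by (intro range_eqI[of _ _ "axis c 1"]) (simp add: Y_def)
  ultimately show ?thesis
    by (intro exI[of _ Y]) (auto simp: generator_matrix_def)
qed

text \<open>Characterizations in terms of the code alone, for any of its generator matrices.\<close>

lemma right_cyclic_column_subset_iff: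
  fixes Y :: "'a::ring_1 ^ 'n ^ 'k"
  assumes "generator_matrix Y C"
  shows "right_cyclic (column i Y) \<subseteq> right_cyclic (column j Y) \<longleftrightarrow>
         (\<exists>r. \<forall>c\<in>C. c $ i = c $ j * r)"
proof -
  have "right_cyclic (column i Y) \<subseteq> right_cyclic (column j Y) \<longleftrightarrow>
        (\<exists>r. \<forall>l. Y $ l $ i = Y $ l $ j * r)"
  proof
    assume "right_cyclic (column i Y) \<subseteq> right_cyclic (column j Y)"
    moreover have "column i Y \<in> right_cyclic (column i Y)"
      unfolding right_cyclic_def by (rule range_eqI[of _ _ 1]) (simp add: right_scale_def vec_eq_iff)
    ultimately have "column i Y \<in> right_cyclic (column j Y)"
      by (rule subsetD)
    then show "\<exists>r. \<forall>l. Y $ l $ i = Y $ l $ j * r"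
      by (auto simp: right_cyclic_def right_scale_def column_def vec_eq_iff)
  next
    assume "\<exists>r. \<forall>l. Y $ l $ i = Y $ l $ j * r"
    then obtain r where r: "\<forall>l. Y $ l $ i = Y $ l $ j * r"
      by (rule exE)
    have "right_scale (column i Y) s = right_scale (column j Y) (r * s)" for s
      by (simp add: right_scale_def column_def vec_eq_iff r mult.assoc)
    then show "right_cyclic (column i Y) \<subseteq> right_cyclic (column j Y)"
      by (auto simp: right_cyclic_def)
  qed
  also have "\<dots> \<longleftrightarrow> (\<exists>r. \<forall>c\<in>C. c $ i = c $ j * r)"
  proof (intro ex_cong1 iffI allI ballI)
    fix r c
    assume r: "\<forall>l. Y $ l $ i = Y $ l $ j * r" and "c \<in> C"
    then obtain x where "c = x v* Y"
      using assms by (auto simp: generator_matrix_def)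
    then show "c $ i = c $ j * r"
      using r by (simp add: vector_matrix_mult_nth sum_distrib_right mult.assoc)
  next
    fix r l
    assume r: "\<forall>c\<in>C. c $ i = c $ j * r"
    have "Y $ l \<in> C"
      using assms axis_vector_matrix_mult[of l Y] by (metis generator_matrix_def rangeI)
    then show "Y $ l $ i = Y $ l $ j * r"
      using r by blast
  qed
  finally show ?thesis .
qed

lemma projective_code_iff:
  fixes Y :: "'a::ring_1 ^ 'n ^ 'k"
  assumes "generator_matrix Y C"
  shows "projective_code Y C \<longleftrightarrow>
    (\<forall>i j. i \<noteq> j \<longrightarrow>
      \<not> ((\<exists>r. \<forall>c\<in>C. c $ i = c $ j * r) \<and> (\<exists>r. \<forall>c\<in>C. c $ j = c $ i * r)))"
  unfolding projective_code_def set_eq_subset right_cyclic_column_subset_iff[OF assms]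
  using assms by blast

lemma barbilian_point_iff:
  fixes y :: "'a::{finite,ring_1} ^ 'k"
  shows "right_cyclic y \<in> barbilian_points \<longleftrightarrow> (\<exists>x :: 'a ^ 'k. (\<Sum>l\<in>UNIV. x $ l * y $ l) = 1)"
proof
  assume "right_cyclic y \<in> barbilian_points"
  then obtain z \<phi> where z: "right_cyclic y = right_cyclic z" "right_linear \<phi>" "\<phi> z = 1"
    by (auto simp: barbilian_points_def)
  have "z \<in> right_cyclic z"
    unfolding right_cyclic_def by (rule range_eqI[of _ _ 1]) (simp add: right_scale_def vec_eq_iff)
  then obtain r where r: "z = right_scale y r"
    using z(1) by (auto simp: right_cyclic_def)
  have add: "\<phi> (u + v) = \<phi> u + \<phi> v" and scale: "\<phi> (right_scale u s) = \<phi> u * s" for u v s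
    using z(2) by (auto simp: right_linear_def)
  have 1: "\<phi> y * r = 1"
    using scale[of y r] z(3) r by simp
  have "inj (\<lambda>s. r * s)"
    by (rule injI) (metis 1 mult.assoc mult_1)
  then have "surj (\<lambda>s. r * s)"
    by (simp add: finite_UNIV_inj_surj)
  then obtain s where "1 = r * s"
    by (metis surjD)
  then have 2: "r * \<phi> y = 1"
    using 1 by (metis mult.assoc mult_1 mult_1_right)
  have 0: "\<phi> 0 = 0"
    using add[of 0 0] by simp
  have sum: "\<phi> (\<Sum>l\<in>A. f l) = (\<Sum>l\<in>A. \<phi> (f l))" if "finite A" for A and f :: "'k \<Rightarrow> 'a ^ 'k"
    using that by (induction A rule: finite_induct) (auto simp: 0 add)
  have "y = (\<Sum>l\<in>UNIV. right_scale (axis l 1) (y $ l))"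
    by (simp add: vec_eq_iff right_scale_def axis_def if_distrib[of "\<lambda>a. a * _"] cong: if_cong)
  then have "\<phi> y = (\<Sum>l\<in>UNIV. \<phi> (axis l 1) * y $ l)"
    using sum[of UNIV "\<lambda>l. right_scale (axis l 1) (y $ l)"] by (simp add: scale)
  then have "(\<Sum>l\<in>UNIV. (\<chi> l. r * \<phi> (axis l 1)) $ l * y $ l) = 1"
    using 2 by (simp add: sum_distrib_left mult.assoc)
  then show "\<exists>x :: 'a ^ 'k. (\<Sum>l\<in>UNIV. x $ l * y $ l) = 1"
    by blast
next
  assume "\<exists>x :: 'a ^ 'k. (\<Sum>l\<in>UNIV. x $ l * y $ l) = 1"
  then obtain x :: "'a ^ 'k" where x: "(\<Sum>l\<in>UNIV. x $ l * y $ l) = 1"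
    by blast
  have "right_linear (\<lambda>z. \<Sum>l\<in>UNIV. x $ l * z $ l)"
    by (simp add: right_linear_def right_scale_def distrib_left sum.distrib sum_distrib_right
        mult.assoc)
  with x show "right_cyclic y \<in> barbilian_points"
    by (auto simp: barbilian_points_def)
qed

lemma regular_code_iff:
  fixes Y :: "'a::{finite,ring_1} ^ 'n ^ 'k"
  assumes "generator_matrix Y C"
  shows "regular_code Y C \<longleftrightarrow> (\<forall>i. (\<lambda>c. c $ i) ` C = UNIV)"
proof -
  have "(\<lambda>c. c $ i) ` C = UNIV \<longleftrightarrow> (\<exists>x. (x v* Y) $ i = 1)" for i
  proof
    assume "(\<lambda>c. c $ i) ` C = UNIV"
    then obtain c where "c \<in> C" "c $ i = 1"
      by (metis UNIV_I imageE)
    then show "\<exists>x. (x v* Y) $ i = 1"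
      using assms by (auto simp: generator_matrix_def)
  next
    assume "\<exists>x. (x v* Y) $ i = 1"
    then obtain x where x: "(x v* Y) $ i = 1"
      by blast
    have "((r *s x) v* Y) $ i = r * (x v* Y) $ i" for r
      by (simp add: vector_matrix_mult_nth sum_distrib_left mult.assoc)
    then have "r = ((r *s x) v* Y) $ i" for r
      by (simp add: x)
    moreover have "(r *s x) v* Y \<in> C" for r
      using assms by (simp add: generator_matrix_def)
    ultimately show "(\<lambda>c. c $ i) ` C = UNIV"
      by (metis (mono_tags, lifting) UNIV_eq_I image_eqI)
  qed
  then show ?thesis
    using assms
    by (simp add: regular_code_def barbilian_point_iff column_def vector_matrix_mult_nth)
qed

section \<open>Strongly regular graphs\<close>

definition simple_graph :: "'v set \<Rightarrow> 'v set set \<Rightarrow> bool" where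
  "simple_graph V E \<longleftrightarrow> finite V \<and> (\<forall>e\<in>E. \<exists>x\<in>V. \<exists>y\<in>V. x \<noteq> y \<and> e = {x, y})"

definition neighbours :: "'v set \<Rightarrow> 'v set set \<Rightarrow> 'v \<Rightarrow> 'v set" where
  "neighbours V E x = {y \<in> V. {x, y} \<in> E}"

definition strongly_regular ::
  "'v set \<Rightarrow> 'v set set \<Rightarrow> nat \<Rightarrow> nat \<Rightarrow> nat \<Rightarrow> nat \<Rightarrow> bool" where
  "strongly_regular V E N K l m \<longleftrightarrow>
     simple_graph V E \<and> card V = N \<and>
     E \<noteq> {} \<and> (\<exists>x\<in>V. \<exists>y\<in>V. x \<noteq> y \<and> {x, y} \<notin> E) \<and>
     (\<forall>x\<in>V. card (neighbours V E x) = K) \<and>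
     (\<forall>x\<in>V. \<forall>y\<in>V. {x, y} \<in> E \<longrightarrow> card (neighbours V E x \<inter> neighbours V E y) = l) \<and>
     (\<forall>x\<in>V. \<forall>y\<in>V. x \<noteq> y \<and> {x, y} \<notin> E \<longrightarrow>
        card (neighbours V E x \<inter> neighbours V E y) = m)"

definition code_graph_edges ::
  "('a::ring_1 \<Rightarrow> real) \<Rightarrow> ('a ^ 'n) set \<Rightarrow> real \<Rightarrow> ('a ^ 'n) set set" where
  "code_graph_edges w C w1 = {{x, y} | x y. x \<in> C \<and> y \<in> C \<and> vec_weight w (x - y) = w1}"

end

theory Submission
  imports Defs "HOL-Library.Product_Plus"
begin

text \<open>
  Put \<open>\<omega> = 1 - w\<close> for the normalized homogeneous weight \<open>w\<close>, and let \<open>\<Omega>(c) = \<Sum>\<^sub>i \<omega>(c\<^sub>i) = n - w(c)\<close>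
  for a codeword \<open>c\<close>. The theorem follows from two facts about \<open>\<Omega>\<close> as a function on the finite
  abelian group \<open>C\<close>: it sums to zero, and it is an idempotent for convolution up to a factor,
  \<open>\<Omega> * \<Omega> = \<kappa> \<Omega>\<close>. On a two-weight code, \<open>\<Omega>\<close> is a combination of the constant function, the indicator
  of \<open>0\<close> and the indicator \<open>A\<close> of the codewords of weight \<open>w\<^sub>1\<close>, so the two facts determine \<open>|A|\<close> and
  \<open>A * A\<close>, which is to say the degree of the graph and its numbers of common neighbours. The values do
  not depend on \<open>\<kappa>\<close>, because evaluation at \<open>0\<close> expresses \<open>\<kappa>\<close> through the degree
  (\<open>two_valued_weight_strongly_regular\<close>).

  The convolution \<open>\<Omega> * \<Omega>\<close> is a sum over pairs of coordinates. For \<open>i = j\<close>, regularity transports the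
  computation to \<open>R\<close>, where \<open>\<omega> * \<omega>\<close> is a multiple of \<open>\<omega>\<close> (\<open>convolution\<close>). For \<open>i \<noteq> j\<close>, regularity and
  projectivity imply that the entries \<open>c\<^sub>i\<close> of the codewords with \<open>c\<^sub>j = 0\<close> form a nonzero left ideal
  (\<open>projective_regular_coordinates\<close>). The contribution vanishes, since \<open>\<omega>\<close> sums to zero over every
  coset of a nonzero left ideal (\<open>sum_coset\<close>).

  Characters of \<open>R\<close> are avoided. Both facts about \<open>\<omega>\<close> come from a uniqueness principle: a function
  that is constant on the generators of each principal left ideal, and sums to zero over each nonzero
  one, is a multiple of \<open>\<omega>\<close> (\<open>multiple_of_\<omega>\<close>). Two ingredients make it applicable.
  \<^item> In a finite Frobenius ring the left socle is principal, and hence so is every left ideal inside it.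
    This extends the vanishing of the sums from principal to arbitrary nonzero left ideals
    (\<open>sum_left_ideal\<close>).
  \<^item> In a finite ring two generators of the same principal left ideal differ by a unit factor on the
    left (\<open>same_left_principal_imp_associated\<close>). Averages and convolutions of \<open>\<omega>\<close> are invariant under
    unit factors, so they are again constant on the generators of a principal left ideal.
\<close>

section \<open>Left ideals\<close>

lemma left_principal_self: "x \<in> left_principal (x :: 'a::ring_1)"
  unfolding left_principal_def by (rule range_eqI[of _ _ 1]) simp

lemma left_principal_mult: "r * x \<in> left_principal (x :: 'a::ring_1)"
  unfolding left_principal_def by (rule rangeI)

lemma left_ideal_left_principal: "left_ideal (left_principal (x :: 'a::ring_1))"
proof -
  have "0 \<in> left_principal x"
    using left_principal_mult[of 0 x] by simp
  moreover have "a * x + b * x \<in> left_principal x" for a b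
    by (metis distrib_right left_principal_mult)
  moreover have "r * (a * x) \<in> left_principal x" for r a
    by (metis mult.assoc left_principal_mult)
  ultimately show ?thesis
    unfolding left_ideal_def by (auto simp: left_principal_def)
qed

lemma left_principal_subset_iff:
  assumes "left_ideal (I :: 'a::ring_1 set)"
  shows "left_principal x \<subseteq> I \<longleftrightarrow> x \<in> I"
  using assms left_principal_self[of x] by (auto simp: left_ideal_def left_principal_def)

lemma left_ideal_diff:
  assumes "left_ideal (I :: 'a::ring_1 set)" "x \<in> I" "y \<in> I"
  shows "x - y \<in> I"
proof -
  have "x + (-1) * y \<in> I"
    using assms unfolding left_ideal_def by blast
  then show ?thesis by simp
qed

lemma left_ideal_plus:
  assumes "left_ideal (I :: 'a::ring_1 set)" "left_ideal J"
  shows "left_ideal (I + J)"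
  unfolding left_ideal_def
proof (intro conjI ballI allI)
  show "0 \<in> I + J"
    using assms set_plus_intro[of 0 I 0 J] by (simp add: left_ideal_def)
next
  fix x y assume "x \<in> I + J" "y \<in> I + J"
  then obtain a b c d where "a \<in> I" "b \<in> J" "x = a + b" "c \<in> I" "d \<in> J" "y = c + d"
    by (auto elim!: set_plus_elim)
  then show "x + y \<in> I + J"
    using assms set_plus_intro[of "a + c" I "b + d" J] by (simp add: left_ideal_def algebra_simps)
next
  fix r x assume "x \<in> I + J"
  then obtain a b where "a \<in> I" "b \<in> J" "x = a + b"
    by (auto elim!: set_plus_elim)
  then show "r * x \<in> I + J"
    using assms set_plus_intro[of "r * a" I "r * b" J] by (simp add: left_ideal_def algebra_simps)
qed

lemma subset_plus_left_ideal:
  assumes "left_ideal (I :: 'a::ring_1 set)" "left_ideal J"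
  shows "I \<subseteq> I + J" "J \<subseteq> I + J"
proof -
  have "x + 0 \<in> I + J" if "x \<in> I" for x
    using that assms by (intro set_plus_intro) (auto simp: left_ideal_def)
  moreover have "0 + x \<in> I + J" if "x \<in> J" for x
    using that assms by (intro set_plus_intro) (auto simp: left_ideal_def)
  ultimately show "I \<subseteq> I + J" "J \<subseteq> I + J" by auto
qed

lemma set_plus_subset_left_ideal:
  assumes "left_ideal (K :: 'a::ring_1 set)" "I \<subseteq> K" "J \<subseteq> K"
  shows "I + J \<subseteq> K"
  using assms by (auto simp: left_ideal_def elim!: set_plus_elim)

section \<open>Sums along additive maps\<close>

text \<open>All nonempty fibres of an additive map are translates of its kernel.\<close>

lemma sum_over_additive_image:
  fixes \<phi> :: "'b::ab_group_add \<Rightarrow> 'c::ab_group_add" and f :: "'c \<Rightarrow> real"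
  assumes fin: "finite K" and zero: "0 \<in> K"
    and diff: "\<And>x y. x \<in> K \<Longrightarrow> y \<in> K \<Longrightarrow> x - y \<in> K"
    and add: "\<And>x y. \<phi> (x + y) = \<phi> x + \<phi> y"
  shows "(\<Sum>k\<in>K. f (\<phi> k)) = real (card {k \<in> K. \<phi> k = 0}) * (\<Sum>a\<in>\<phi> ` K. f a)"
proof -
  have sub: "x + y \<in> K" if "x \<in> K" "y \<in> K" for x y
    using diff[OF that(1) diff[OF zero that(2)]] by simp
  have phi_diff: "\<phi> (x - y) = \<phi> x - \<phi> y" for x y
    using add[of "x - y" y] by simp
  have "(\<Sum>k\<in>K. f (\<phi> k)) = (\<Sum>a\<in>\<phi> ` K. \<Sum>k\<in>{k \<in> K. \<phi> k = a}. f (\<phi> k))"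
    by (rule sum.image_gen[OF fin])
  also have "\<dots> = (\<Sum>a\<in>\<phi> ` K. real (card {k \<in> K. \<phi> k = 0}) * f a)"
  proof (rule sum.cong[OF refl])
    fix a assume "a \<in> \<phi> ` K"
    then obtain k0 where k0: "k0 \<in> K" "a = \<phi> k0" by blast
    have "bij_betw (\<lambda>k. k0 + k) {k \<in> K. \<phi> k = 0} {k \<in> K. \<phi> k = a}"
      by (rule bij_betw_byWitness[where f' = "\<lambda>k. k - k0"])
         (use k0 sub diff phi_diff add in auto)
    then have "card {k \<in> K. \<phi> k = 0} = card {k \<in> K. \<phi> k = a}"
      by (rule bij_betw_same_card)
    then show "(\<Sum>k\<in>{k \<in> K. \<phi> k = a}. f (\<phi> k)) = real (card {k \<in> K. \<phi> k = 0}) * f a"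
      by simp
  qed
  finally show ?thesis by (simp add: sum_distrib_left)
qed

text \<open>The map \<open>(x, y) \<mapsto> x r + y\<close> on \<open>I \<times> J\<close> is additive, and its kernel projects bijectively onto the
  \<open>x \<in> I\<close> with \<open>x r \<in> J\<close>. Applied with \<open>f = 1\<close> this counts cosets; with \<open>r = 1\<close> it sums over \<open>I + J\<close>.\<close>

lemma sum_over_pairs:
  fixes I :: "'a::{finite,ring_1} set" and f :: "'a \<Rightarrow> real"
  assumes "0 \<in> I" "0 \<in> J"
    and "\<And>x y. x \<in> I \<Longrightarrow> y \<in> I \<Longrightarrow> x - y \<in> I" "\<And>x y. x \<in> J \<Longrightarrow> y \<in> J \<Longrightarrow> x - y \<in> J"
  shows "(\<Sum>x\<in>I. \<Sum>y\<in>J. f (x * r + y))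
    = real (card {x \<in> I. x * r \<in> J}) * (\<Sum>z\<in>(\<lambda>x. x * r) ` I + J. f z)"
proof -
  have minus: "- y \<in> J" if "y \<in> J" for y
    using assms(4)[OF assms(2) that] by simp
  have "(\<Sum>x\<in>I. \<Sum>y\<in>J. f (x * r + y)) = (\<Sum>k\<in>I \<times> J. f (fst k * r + snd k))"
    by (simp add: sum.cartesian_product case_prod_beta)
  also have "\<dots> = real (card {k \<in> I \<times> J. fst k * r + snd k = 0})
      * (\<Sum>z\<in>(\<lambda>k. fst k * r + snd k) ` (I \<times> J). f z)"
    by (rule sum_over_additive_image[where \<phi> = "\<lambda>k. fst k * r + snd k"])
       (use assms in \<open>auto simp: zero_prod_def algebra_simps\<close>)
  also have "(\<lambda>k. fst k * r + snd k) ` (I \<times> J) = (\<lambda>x. x * r) ` I + J"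
    by (force simp: set_plus_def image_iff)
  also have "card {k \<in> I \<times> J. fst k * r + snd k = 0} = card {x \<in> I. x * r \<in> J}"
  proof (rule bij_betw_same_card)
    show "bij_betw fst {k \<in> I \<times> J. fst k * r + snd k = 0} {x \<in> I. x * r \<in> J}"
      by (rule bij_betw_byWitness[where f' = "\<lambda>x. (x, - (x * r))"])
         (use minus in \<open>auto simp: eq_neg_iff_add_eq_0[symmetric] add_eq_0_iff\<close>)
  qed
  finally show ?thesis .
qed

section \<open>Generators of principal left ideals in a finite ring\<close>

lemma finite_ring_left_inverse_imp_right_inverse:
  fixes x y :: "'a::{finite,ring_1}"
  assumes "y * x = 1"
  shows "x * y = 1"
proof -
  have "inj (\<lambda>s. x * s)"
    by (rule injI) (metis assms mult.assoc mult_1)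
  then have "surj (\<lambda>s. x * s)"
    by (simp add: finite_UNIV_inj_surj)
  then obtain s where "1 = x * s"
    by (metis surjD)
  then show ?thesis
    using assms by (metis mult.assoc mult_1 mult_1_right)
qed

text \<open>The powers of \<open>a\<close> are eventually periodic, with some period \<open>p\<close>; the power at any multiple of \<open>p\<close>
  past the preperiod is idempotent.\<close>

lemma finite_ring_idempotent_power:
  fixes a :: "'a::{finite,ring_1}"
  shows "\<exists>m>0. a ^ m * a ^ m = a ^ m"
proof -
  have "\<not> inj (\<lambda>k::nat. a ^ k)"
    using finite_imageD[of "\<lambda>k::nat. a ^ k" UNIV] by auto
  then obtain i j where "i < j" "a ^ i = a ^ j"
    unfolding inj_def by (metis nat_neq_iff)
  then obtain p where p: "p > 0" "a ^ i = a ^ (i + p)"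
    by (metis less_imp_add_positive)
  have step: "a ^ (k + p) = a ^ k" if "i \<le> k" for k
    using p(2) that by (metis add.commute le_add_diff_inverse power_add add.assoc)
  have steps: "a ^ (k + q * p) = a ^ k" if "i \<le> k" for k q
  proof (induction q)
    case (Suc q)
    then show ?case
      using step[of "k + q * p"] that by (simp add: algebra_simps)
  qed simp
  have "i \<le> Suc i * p"
    using p(1) by (cases p) auto
  then have "a ^ (Suc i * p) * a ^ (Suc i * p) = a ^ (Suc i * p)"
    using steps[of "Suc i * p" "Suc i"] by (simp add: power_add)
  then show ?thesis
    using p(1) by (intro exI[of _ "Suc i * p"]) simp
qed

text \<open>The elementwise description of the Jacobson radical. It gives directly what
  matters below: \<open>1 - a\<close> is left invertible for \<open>a\<close> in the radical, the radical is a two-sided ideal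
  without nonzero idempotents, and a left ideal not contained in it has a nonzero idempotent.\<close>

definition unit_radical :: "'a::ring_1 set" where
  "unit_radical = {a. \<forall>r. \<exists>v. v * (1 - r * a) = 1}"

lemma left_ideal_unit_radical: "left_ideal (unit_radical :: 'a::{finite,ring_1} set)"
  unfolding left_ideal_def
proof (intro conjI ballI allI)
  show "0 \<in> (unit_radical :: 'a set)"
    by (auto simp: unit_radical_def)
next
  fix a b :: 'a assume a: "a \<in> unit_radical" and b: "b \<in> unit_radical"
  show "a + b \<in> unit_radical"
    unfolding unit_radical_def
  proof (intro CollectI allI)
    fix r
    obtain v where v: "v * (1 - r * a) = 1"
      using a by (auto simp: unit_radical_def)
    obtain v' where v': "v' * (1 - (v * r) * b) = 1"
      using b unfolding unit_radical_def by blast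
    have "v * (1 - r * (a + b)) = 1 - (v * r) * b"
      using v by (simp add: algebra_simps)
    then have "(v' * v) * (1 - r * (a + b)) = 1"
      using v' by (simp add: mult.assoc)
    then show "\<exists>v. v * (1 - r * (a + b)) = 1" by blast
  qed
next
  fix r a :: 'a assume "a \<in> unit_radical"
  then show "r * a \<in> unit_radical"
    by (simp add: unit_radical_def mult.assoc[symmetric])
qed

text \<open>If \<open>v\<close> is a left inverse of \<open>1 - y x\<close>, then \<open>1 + x v y\<close> is one of \<open>1 - x y\<close>; here \<open>x = r a\<close> and
  \<open>y = s\<close>.\<close>

lemma unit_radical_mult_right:
  fixes a :: "'a::{finite,ring_1}"
  assumes "a \<in> unit_radical"
  shows "a * s \<in> unit_radical"
  unfolding unit_radical_def
proof (intro CollectI allI)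
  fix r
  obtain v where v: "v * (1 - (s * r) * a) = 1"
    using assms unfolding unit_radical_def by blast
  have "v * s - v * s * r * a * s = (v * (1 - (s * r) * a)) * s"
    by (simp add: algebra_simps)
  then have vs: "v * s - v * s * r * a * s = s"
    by (simp add: v)
  have "(1 + r * a * v * s) * (1 - r * (a * s))
      = 1 - r * a * s + r * a * (v * s - v * s * r * a * s)"
    by (simp add: algebra_simps)
  also have "\<dots> = 1"
    unfolding vs by (simp add: algebra_simps)
  finally show "\<exists>v. v * (1 - r * (a * s)) = 1" by blast
qed

lemma unit_radical_idempotent:
  fixes e :: "'a::{finite,ring_1}"
  assumes "e \<in> unit_radical" "e * e = e"
  shows "e = 0"
proof -
  obtain v where "v * (1 - 1 * e) = 1"
    using assms(1) unfolding unit_radical_def by blast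
  then have "(1 - e) * v = 1"
    using finite_ring_left_inverse_imp_right_inverse[of v "1 - e"] by simp
  then have "e = e * ((1 - e) * v)" by simp
  also have "\<dots> = (e - e * e) * v" by (simp add: algebra_simps)
  finally show ?thesis using assms(2) by simp
qed

text \<open>If \<open>1 - r a\<close> has no left inverse, then \<open>r a\<close> is not nilpotent, so its idempotent power is nonzero.\<close>

lemma left_ideal_idempotent:
  fixes A :: "'a::{finite,ring_1} set"
  assumes "left_ideal A" "\<not> A \<subseteq> unit_radical"
  obtains e where "e \<in> A" "e * e = e" "e \<noteq> 0"
proof -
  obtain a where a: "a \<in> A" "a \<notin> unit_radical"
    using assms(2) by blast
  then obtain r where r: "\<nexists>v. v * (1 - r * a) = 1"
    by (auto simp: unit_radical_def)
  obtain m where m: "m > 0" "(r * a) ^ m * (r * a) ^ m = (r * a) ^ m"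
    using finite_ring_idempotent_power by blast
  have "(r * a) ^ m = ((r * a) ^ (m - 1) * r) * a"
    using m(1) by (metis mult.assoc power_minus_mult)
  then have 1: "(r * a) ^ m \<in> A"
    using assms(1) a(1) by (simp add: left_ideal_def)
  have "(r * a) ^ m \<noteq> 0"
  proof
    assume nil: "(r * a) ^ m = 0"
    have "inj (\<lambda>y. y * (1 - r * a))"
    proof (rule injI)
      fix y z assume "y * (1 - r * a) = z * (1 - r * a)"
      then have eq: "y - z = (y - z) * (r * a)"
        by (simp add: algebra_simps)
      have "y - z = (y - z) * (r * a) ^ k" for k
      proof (induction k)
        case (Suc k)
        then show ?case
          using eq by (metis mult.assoc power_Suc)
      qed simp
      then show "y = z"
        using nil by (metis eq_iff_diff_eq_0 mult_zero_right)
    qed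
    then have "surj (\<lambda>y. y * (1 - r * a))"
      by (simp add: finite_UNIV_inj_surj)
    then show False
      using r by (metis surjD)
  qed
  with 1 m(2) show ?thesis by (rule that)
qed

text \<open>In the finite group \<open>L/J\<close>, with \<open>J\<close> the radical, right multiplication by \<open>x\<close> is injective iff its
  image has as many elements as \<open>L/J\<close>. Both sides are stated by representatives, which avoids quotients.\<close>

lemma radical_coset_count:
  fixes x :: "'a::{finite,ring_1}"
  assumes L: "unit_radical \<subseteq> L" "\<And>a b. a \<in> L \<Longrightarrow> b \<in> L \<Longrightarrow> a - b \<in> L"
  shows "{a \<in> L. a * x \<in> unit_radical} = unit_radical
    \<longleftrightarrow> card ((\<lambda>a. a * x) ` L + unit_radical) = card L"
proof -
  let ?J = "unit_radical :: 'a set" and ?A = "{a \<in> L. a * x \<in> unit_radical}"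
  note J = left_ideal_unit_radical[where 'a='a]
  have 0: "0 \<in> ?J" using J by (simp add: left_ideal_def)
  then have L0: "0 \<in> L" using L(1) by blast
  have "real (card L) * real (card ?J)
      = real (card ?A) * real (card ((\<lambda>a. a * x) ` L + ?J))"
    using sum_over_pairs[of L ?J "\<lambda>_. 1" x] 0 L0 L(2) left_ideal_diff[OF J] by simp
  then have count: "card L * card ?J = card ?A * card ((\<lambda>a. a * x) ` L + ?J)"
    unfolding of_nat_mult[symmetric] of_nat_eq_iff .
  have sub: "?J \<subseteq> ?A"
    using L(1) unit_radical_mult_right by auto
  have pos: "card ?J > 0" "card L > 0"
    using 0 L0 by (auto simp: card_gt_0_iff)
  have "?A = ?J \<longleftrightarrow> card ?A = card ?J"
    using card_subset_eq[OF finite sub] by auto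
  also have "\<dots> \<longleftrightarrow> card ((\<lambda>a. a * x) ` L + ?J) = card L"
  proof -
    have "a = j \<longleftrightarrow> m = l" if "l * j = a * m" "j > 0" "l > 0" for a j l m :: nat
      using that by (metis mult.commute mult_left_cancel not_gr_zero)
    from this[OF count pos] show ?thesis .
  qed
  finally show ?thesis .
qed

text \<open>The step of an exchange argument showing that finite rings have stable range one. Write \<open>J\<close> for the
  radical. Since \<open>R x + J\<close> is not the whole ring, right multiplication by \<open>x\<close> is not injective modulo
  \<open>J\<close>, and there is an idempotent \<open>e \<noteq> 0\<close> with \<open>e x \<in> J\<close>. Adding an element \<open>e t c\<close> to \<open>x\<close> then loses
  nothing, because multiplication by \<open>1 - e\<close> recovers \<open>x\<close> modulo \<open>J\<close>. If every \<open>e t c\<close> lay in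
  \<open>R x + J\<close> already, then \<open>e R \<subseteq> e R x + J\<close>. Right multiplication by \<open>x\<close> would be surjective, hence
  injective, on \<open>(e R + J)/J\<close>, contradicting \<open>e x \<in> J\<close>.\<close>

lemma enlarge_left_principal:
  fixes x c :: "'a::{finite,ring_1}"
  assumes span: "left_principal x + left_principal c = UNIV"
    and not_all: "left_principal x + unit_radical \<noteq> UNIV"
  shows "\<exists>t. left_principal x + unit_radical \<subset> left_principal (x + t * c) + unit_radical"
proof -
  let ?J = "unit_radical :: 'a set"
  let ?X = "left_principal x + ?J"
  note J = left_ideal_unit_radical[where 'a='a]
  have J_mult: "r * j \<in> ?J" if "j \<in> ?J" for r j
    using J that by (simp add: left_ideal_def)
  define A where "A = {a. a * x \<in> ?J}"
  have A: "left_ideal A"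
    using J by (auto simp: A_def left_ideal_def distrib_right mult.assoc)
  have "\<not> A \<subseteq> ?J"
  proof
    assume "A \<subseteq> ?J"
    then have "{a \<in> UNIV. a * x \<in> ?J} = ?J"
      using unit_radical_mult_right by (auto simp: A_def)
    then have "card ?X = card (UNIV :: 'a set)"
      using radical_coset_count[of UNIV x] by (simp add: left_principal_def)
    then show False
      using not_all by (metis card_subset_eq finite subset_UNIV)
  qed
  then obtain e where e: "e * x \<in> ?J" "e * e = e" "e \<noteq> 0"
    using left_ideal_idempotent[OF A] by (metis A_def mem_Collect_eq)
  have "\<exists>t. e * t * c \<notin> ?X"
  proof (rule ccontr)
    assume "\<not> (\<exists>t. e * t * c \<notin> ?X)"
    then have c: "e * t * c \<in> ?X" for t by blast
    define L where "L = range (\<lambda>s. e * s) + ?J"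
    have eL: "e * s + j \<in> L" if "j \<in> ?J" for s j
      unfolding L_def using that by (intro set_plus_intro) auto
    have 0: "0 \<in> ?J" using J by (simp add: left_ideal_def)
    have e_in: "e * s \<in> L" for s
      using eL[OF 0, of s] by simp
    have L_sub: "?J \<subseteq> L"
      using eL[of _ 0] by auto
    have L_diff: "a - b \<in> L" if ab: "a \<in> L" "b \<in> L" for a b
    proof -
      obtain s j s' j' where "a = e * s + j" "b = e * s' + j'" "j \<in> ?J" "j' \<in> ?J"
        using ab unfolding L_def by (auto elim!: set_plus_elim)
      then show ?thesis
        using eL[OF left_ideal_diff[OF J], of j j' "s - s'"] by (simp add: algebra_simps)
    qed
    have eR: "e * s \<in> (\<lambda>a. a * x) ` L + ?J" for s
    proof -
      obtain p q where s: "s = p * x + q * c"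
        using span unfolding left_principal_def
        by (metis (no_types, lifting) UNIV_I rangeE set_plus_elim)
      obtain a j where aj: "e * q * c = a * x + j" "j \<in> ?J"
        using c[of q] unfolding left_principal_def
        by (metis (no_types, lifting) rangeE set_plus_elim)
      \<comment> \<open>Idempotency allows a second factor \<open>e\<close>, which puts the multiplier of \<open>x\<close> into \<open>e R\<close>.\<close>
      have "e * s = e * (e * p * x + e * q * c)"
        using e(2) by (simp add: s distrib_left mult.assoc[symmetric])
      also have "\<dots> = (e * (e * p + a)) * x + e * j"
        using aj(1) by (simp add: algebra_simps)
      finally show ?thesis
        using set_plus_intro[of "(e * (e * p + a)) * x" "(\<lambda>a. a * x) ` L" "e * j" ?J]
          J_mult[OF aj(2)] e_in by simp
    qed
    have "L \<subseteq> (\<lambda>a. a * x) ` L + ?J"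
    proof
      fix l assume "l \<in> L"
      then obtain s j where l: "l = e * s + j" "j \<in> ?J"
        unfolding L_def by (auto elim!: set_plus_elim)
      obtain a j' where a: "e * s = a + j'" "a \<in> (\<lambda>a. a * x) ` L" "j' \<in> ?J"
        using eR[of s] by (auto elim!: set_plus_elim)
      have "j' + j \<in> ?J"
        using J a(3) l(2) by (simp add: left_ideal_def)
      then show "l \<in> (\<lambda>a. a * x) ` L + ?J"
        using set_plus_intro[OF a(2), of "j' + j"] l(1) a(1) by (simp add: add.assoc)
    qed
    moreover have "(\<lambda>a. a * x) ` L + ?J \<subseteq> L"
    proof
      fix l assume "l \<in> (\<lambda>a. a * x) ` L + ?J"
      then obtain s j j' where "l = (e * s + j) * x + j'" "j \<in> ?J" "j' \<in> ?J"
        unfolding L_def by (auto elim!: set_plus_elim)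
      moreover from this have "j * x + j' \<in> ?J"
        using J unit_radical_mult_right[of j x] by (simp add: left_ideal_def)
      ultimately show "l \<in> L"
        using eL[of "j * x + j'" "s * x"] by (simp add: algebra_simps)
    qed
    ultimately have "{a \<in> L. a * x \<in> ?J} = ?J"
      using radical_coset_count[OF L_sub L_diff, of x] by auto
    then have "e \<in> ?J"
      using e(1) e_in[of 1] by auto
    then show False
      using unit_radical_idempotent e by blast
  qed
  then obtain t where t: "e * t * c \<notin> ?X" by blast
  define y where "y = x + e * t * c"
  let ?Y = "left_principal y + ?J"
  have Y: "left_ideal ?Y" and X: "left_ideal ?X"
    by (intro left_ideal_plus left_ideal_left_principal J)+
  note Y_sub = subset_plus_left_ideal[OF left_ideal_left_principal J]
  \<comment> \<open>\<open>(1 - e) e = 0\<close> removes the added term.\<close>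
  have "x = (1 - e) * y + e * x"
    using e(2) by (simp add: y_def algebra_simps) (metis mult.assoc)
  then have x: "x \<in> ?Y"
    using set_plus_intro[OF left_principal_mult e(1)] by metis
  have "y \<in> ?Y"
    using Y_sub left_principal_self by blast
  then have "y - x \<in> ?Y"
    using left_ideal_diff[OF Y _ x] by blast
  then have "e * t * c \<in> ?Y" by (simp add: y_def)
  moreover have "?X \<subseteq> ?Y"
  proof -
    have "left_principal x \<subseteq> ?Y"
      using x left_principal_subset_iff[OF Y] by blast
    then show ?thesis
      using set_plus_subset_left_ideal[OF Y] Y_sub by blast
  qed
  ultimately have "?X \<subset> ?Y"
    using t by blast
  then show ?thesis
    unfolding y_def by blast
qed

text \<open>With \<open>b = r a\<close> and \<open>a = s b\<close>, the element \<open>c = 1 - s u\<close> kills \<open>a\<close> whenever \<open>u a = b\<close>, so \<open>u\<close> may be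
  changed by left multiples of \<open>c\<close>. Enlarging \<open>R u\<close> modulo the radical as long as possible makes \<open>u\<close> a
  unit.\<close>

lemma same_left_principal_imp_associated:
  fixes a b :: "'a::{finite,ring_1}"
  assumes "left_principal a = left_principal b"
  obtains u v where "v * u = 1" "u * v = 1" "b = u * a"
proof -
  let ?J = "unit_radical :: 'a set"
  let ?size = "\<lambda>u. card (left_principal u + ?J)"
  note J = left_ideal_unit_radical[where 'a='a]
  obtain r s where r: "b = r * a" and s: "a = s * b"
    using assms left_principal_self[of a] left_principal_self[of b]
    unfolding left_principal_def by (metis rangeE)
  obtain u where u: "u * a = b" and max: "\<And>u'. u' * a = b \<Longrightarrow> ?size u' \<le> ?size u"
  proof -
    have "{u. u * a = b} \<noteq> {}" using r by auto
    then obtain u where u: "u \<in> {u. u * a = b}" "Max (?size ` {u. u * a = b}) = ?size u"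
      using obtains_MAX[OF finite, of "{u. u * a = b}" ?size] by blast
    have "?size u' \<le> ?size u" if "u' * a = b" for u'
      unfolding u(2)[symmetric] using that by (intro Max_ge) auto
    with u(1) show ?thesis
      by (intro that[of u]) auto
  qed
  define c where "c = 1 - s * u"
  have ca: "c * a = 0"
    using u s by (simp add: c_def algebra_simps)
  have span: "left_principal u + left_principal c = UNIV"
  proof -
    have "t = (t * s) * u + t * c" for t
      by (simp add: c_def algebra_simps)
    then show ?thesis
      by (metis UNIV_eq_I left_principal_mult set_plus_intro)
  qed
  have "left_principal u + ?J = UNIV"
  proof (rule ccontr)
    assume "left_principal u + ?J \<noteq> UNIV"
    then obtain t where t: "left_principal u + ?J \<subset> left_principal (u + t * c) + ?J"
      using enlarge_left_principal[OF span] by blast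
    have "(u + t * c) * a = b"
      using u ca by (simp add: distrib_right mult.assoc)
    then show False
      using max psubset_card_mono[OF finite t] by fastforce
  qed
  then obtain p j where "1 = p * u + j" "j \<in> ?J"
    unfolding left_principal_def by (metis (no_types, lifting) UNIV_I rangeE set_plus_elim)
  moreover from this obtain v where "v * (1 - 1 * j) = 1"
    unfolding unit_radical_def by blast
  moreover have "p * u = 1 - j"
    using \<open>1 = p * u + j\<close> by (metis add_diff_cancel_right')
  ultimately have "(v * p) * u = 1"
    by (simp add: mult.assoc)
  then show ?thesis
    using finite_ring_left_inverse_imp_right_inverse u that by blast
qed

section \<open>The socle of a finite Frobenius ring\<close>

lemma left_ideal_left_socle: "left_ideal (left_socle :: 'a::ring_1 set)"
  unfolding left_socle_def by (rule hull_in) (auto simp: left_ideal_def)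

lemma minimal_left_ideal_subset_socle:
  "minimal_left_ideal L \<Longrightarrow> L \<subseteq> left_socle"
  unfolding left_socle_def using hull_subset[of "\<Union>{I. minimal_left_ideal I}" left_ideal] by blast

lemma minimal_left_ideal_exists:
  fixes I :: "'a::{finite,ring_1} set"
  assumes "left_ideal I" "I \<noteq> {0}"
  shows "\<exists>L. minimal_left_ideal L \<and> L \<subseteq> I"
  using finite[of I] assms
proof (induction I rule: finite_psubset_induct)
  case (psubset I)
  show ?case
  proof (cases "minimal_left_ideal I")
    case False
    then obtain J where "left_ideal J" "J \<subset> I" "J \<noteq> {0}"
      using psubset.prems unfolding minimal_left_ideal_def by blast
    then show ?thesis
      using psubset.IH[of J] by blast
  qed blast
qed

text \<open>The quotient by the radical is generated by the coset of \<open>1\<close>, and the isomorphism carries this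
  generator back to the socle.\<close>

lemma frobenius_ring_socle_principal:
  assumes "frobenius_ring TYPE('a::{finite,ring_1})"
  shows "\<exists>s :: 'a. left_socle = left_principal s"
proof -
  let ?S = "left_socle :: 'a set" and ?J = "jacobson_radical :: 'a set"
  obtain f where bij: "bij_betw f ?S (range (\<lambda>a::'a. a +o ?J))"
    and smul: "\<And>r x. x \<in> ?S \<Longrightarrow> f (r * x) = r *o f x + ?J"
    using assms unfolding frobenius_ring_def left_module_iso_def by auto
  have J: "left_ideal ?J"
    unfolding jacobson_radical_def left_ideal_def
    by (auto simp: maximal_left_ideal_def left_ideal_def)
  have "1 +o ?J \<in> f ` ?S"
    using bij unfolding bij_betw_def by blast
  then obtain s where s: "s \<in> ?S" "f s = 1 +o ?J"
    by auto
  have f_mult: "f (r * s) = r +o ?J" for r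
  proof -
    have "r *o (1 +o ?J) + ?J = r +o ?J"
    proof
      show "r *o (1 +o ?J) + ?J \<subseteq> r +o ?J"
        using J by (auto simp: elt_set_plus_def elt_set_times_def set_plus_def left_ideal_def
            distrib_left add.assoc)
      have "0 \<in> ?J" using J by (simp add: left_ideal_def)
      then show "r +o ?J \<subseteq> r *o (1 +o ?J) + ?J"
        by (force simp: elt_set_plus_def elt_set_times_def set_plus_def)
    qed
    then show ?thesis
      using smul[OF s(1)] s(2) by simp
  qed
  have Rs: "r * s \<in> ?S" for r
    using left_ideal_left_socle s(1) by (auto simp: left_ideal_def)
  have "x \<in> left_principal s" if x: "x \<in> ?S" for x
  proof -
    obtain a where "f x = a +o ?J"
      using bij x unfolding bij_betw_def by blast
    then have "x = a * s"
      using bij x Rs f_mult unfolding bij_betw_def inj_on_def by metis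
    then show ?thesis
      by (simp add: left_principal_mult)
  qed
  moreover have "left_principal s \<subseteq> ?S"
    using left_principal_subset_iff[OF left_ideal_left_socle] s(1) by blast
  ultimately show ?thesis by blast
qed

lemma left_ideal_Int: "left_ideal I \<Longrightarrow> left_ideal J \<Longrightarrow> left_ideal (I \<inter> J)"
  by (auto simp: left_ideal_def)

text \<open>The socle is semisimple, so \<open>T\<close> has a complement: take a largest left ideal \<open>T'\<close> meeting \<open>T\<close> only in
  \<open>0\<close>. Then \<open>T + T'\<close> contains every minimal left ideal, hence the socle, and the \<open>T\<close>-component of the
  generator \<open>s\<close> generates \<open>T\<close>.\<close>

lemma left_ideal_of_principal_socle:
  fixes T :: "'a::{finite,ring_1} set"
  assumes socle: "left_socle = left_principal (s :: 'a)"
    and T: "left_ideal T" "T \<subseteq> left_socle"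
  obtains t where "T = left_principal t"
proof -
  let ?F = "{T'. left_ideal T' \<and> T \<inter> T' = {0}}"
  have "{0} \<in> ?F"
    using T(1) by (auto simp: left_ideal_def)
  then have "?F \<noteq> {}" by blast
  then obtain T' where T': "T' \<in> ?F" "Max (card ` ?F) = card T'"
    by (rule obtains_MAX[OF finite])
  have max: "card U \<le> card T'" if "U \<in> ?F" for U
    unfolding T'(2)[symmetric] using that by (intro Max_ge) auto
  have li: "left_ideal T'" and disj: "T \<inter> T' = {0}"
    using T'(1) by auto
  have TT': "left_ideal (T + T')"
    by (rule left_ideal_plus[OF T(1) li])
  have minimal: "L \<subseteq> T + T'" if L: "minimal_left_ideal L" for L
  proof (rule ccontr)
    assume not: "\<not> L \<subseteq> T + T'"
    have liL: "left_ideal L" using L by (simp add: minimal_left_ideal_def)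
    have "L \<inter> (T + T') = {0}"
      using L not left_ideal_Int[OF liL TT'] unfolding minimal_left_ideal_def by blast
    then have ind: "l = 0" if "l \<in> L" "l \<in> T + T'" for l
      using that by blast
    have "x = 0" if x: "x \<in> T" "x \<in> T' + L" for x
    proof -
      obtain t' l where tl: "x = t' + l" "t' \<in> T'" "l \<in> L"
        using x(2) by (auto elim!: set_plus_elim)
      have "x \<in> T + T'" "t' \<in> T + T'"
        using subset_plus_left_ideal[OF T(1) li] x(1) tl(2) by auto
      then have "l \<in> T + T'"
        using left_ideal_diff[OF TT', of x t'] tl(1) by simp
      then have "l = 0"
        by (rule ind[OF tl(3)])
      then have "x \<in> T'"
        using tl(1,2) by simp
      then show "x = 0"
        using disj x(1) by blast
    qed
    then have "T' + L \<in> ?F"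
      using left_ideal_plus[OF li liL] T(1) by (auto simp: left_ideal_def)
    then have "T' = T' + L"
      using max subset_plus_left_ideal(1)[OF li liL] by (metis card_seteq finite)
    then have "L \<subseteq> T + T'"
      using subset_plus_left_ideal(2)[OF li liL] subset_plus_left_ideal(2)[OF T(1) li] by blast
    then show False using not by blast
  qed
  have "left_socle \<subseteq> T + T'"
    unfolding left_socle_def by (rule hull_minimal) (use minimal TT' in auto)
  then have "s \<in> T + T'"
    using socle left_principal_self by blast
  then obtain t t' where s: "s = t + t'" "t \<in> T" "t' \<in> T'"
    by (auto elim!: set_plus_elim)
  have "x \<in> left_principal t" if x: "x \<in> T" for x
  proof -
    obtain r where r: "x = r * s"
      using x T(2) socle by (auto simp: left_principal_def)
    have "r * t \<in> T" "r * t' \<in> T'"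
      using s T(1) li by (auto simp: left_ideal_def)
    moreover have "x - r * t = r * t'"
      by (simp add: r s(1) distrib_left)
    ultimately have "x - r * t \<in> T \<inter> T'"
      using left_ideal_diff[OF T(1) x, of "r * t"] by simp
    then have "x = r * t"
      using disj by simp
    then show ?thesis
      by (simp add: left_principal_mult)
  qed
  moreover have "left_principal t \<subseteq> T"
    using left_principal_subset_iff[OF T(1)] s(2) by blast
  ultimately show ?thesis
    using that by blast
qed

section \<open>Functions with vanishing sums over principal left ideals\<close>

text \<open>By induction on the size of \<open>R x\<close>: the sum over \<open>R x\<close> reduces to the generators of \<open>R x\<close>, on which
  \<open>f\<close> takes the value \<open>f x\<close>.\<close>

lemma eq_zero_if_principal_sums_vanish:
  fixes f :: "'a::{finite,ring_1} \<Rightarrow> real"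
  assumes zero: "f 0 = 0"
    and same: "\<And>x y. left_principal x = left_principal y \<Longrightarrow> f x = f y"
    and sums: "\<And>x. x \<noteq> 0 \<Longrightarrow> (\<Sum>y\<in>left_principal x. f y) = 0"
  shows "f x = 0"
proof (induction "card (left_principal x)" arbitrary: x rule: less_induct)
  case less
  show ?case
  proof (cases "x = 0")
    case False
    let ?G = "{y \<in> left_principal x. left_principal y = left_principal x}"
    have smaller: "f y = 0" if "y \<in> left_principal x - ?G" for y
    proof (rule less)
      have "left_principal y \<subset> left_principal x"
        using that left_principal_subset_iff[OF left_ideal_left_principal, of y x] by blast
      then show "card (left_principal y) < card (left_principal x)"
        by (simp add: psubset_card_mono)
    qed
    have "0 = (\<Sum>y\<in>left_principal x. f y)"
      using sums[OF False] by simp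
    also have "\<dots> = (\<Sum>y\<in>?G. f y)"
      by (rule sum.mono_neutral_right) (use smaller in auto)
    also have "\<dots> = (\<Sum>y\<in>?G. f x)"
      by (rule sum.cong[OF refl]) (use same in blast)
    also have "\<dots> = real (card ?G) * f x" by simp
    finally show "f x = 0"
      using left_principal_self[of x] by (auto simp: card_eq_0_iff)
  qed (simp add: zero)
qed

text \<open>In the application \<open>\<omega> = 1 - w\<close> for the normalized homogeneous weight \<open>w\<close>. The Frobenius property
  enters through a generator of the left socle.\<close>

locale principal_mean_zero =
  fixes \<omega> :: "'a::{finite,ring_1} \<Rightarrow> real"
  assumes at_zero: "\<omega> 0 = 1"
    and same_principal: "\<And>x y. left_principal x = left_principal y \<Longrightarrow> \<omega> x = \<omega> y"
    and sum_principal: "\<And>x. x \<noteq> 0 \<Longrightarrow> (\<Sum>y\<in>left_principal x. \<omega> y) = 0"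
    and socle: "\<exists>s :: 'a. left_socle = left_principal s"
begin

lemma multiple_of_\<omega>:
  assumes "\<And>x y. left_principal x = left_principal y \<Longrightarrow> f x = f y"
    and "\<And>x. x \<noteq> 0 \<Longrightarrow> (\<Sum>y\<in>left_principal x. f y) = 0"
  shows "f x = f 0 * \<omega> x"
proof -
  have "f x - f 0 * \<omega> x = 0"
  proof (rule eq_zero_if_principal_sums_vanish[where f = "\<lambda>x. f x - f 0 * \<omega> x"])
    show "f 0 - f 0 * \<omega> 0 = 0"
      by (simp add: at_zero)
  next
    fix x y :: 'a assume "left_principal x = left_principal y"
    then show "f x - f 0 * \<omega> x = f y - f 0 * \<omega> y"
      using assms(1) same_principal by metis
  next
    fix x :: 'a assume "x \<noteq> 0"
    then show "(\<Sum>y\<in>left_principal x. f y - f 0 * \<omega> y) = 0"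
      using assms(2) sum_principal by (simp add: sum_subtractf sum_distrib_left[symmetric])
  qed
  then show ?thesis by simp
qed

lemma unit_mult:
  assumes "v * u = 1"
  shows "\<omega> (u * y) = \<omega> y"
proof (rule same_principal)
  have "y = v * (u * y)"
    by (simp add: mult.assoc[symmetric] assms)
  then have "y \<in> left_principal (u * y)"
    by (metis left_principal_mult)
  then show "left_principal (u * y) = left_principal y"
    using left_principal_subset_iff[OF left_ideal_left_principal] left_principal_mult
    by (metis subset_antisym)
qed

lemma minus: "\<omega> (- y) = \<omega> y"
  using unit_mult[of "-1" "-1" y] by simp

text \<open>The intersection with the socle is a principal left ideal, and it is nonzero because \<open>I\<close> contains a
  minimal left ideal.\<close>

lemma sum_socle_left_ideal:
  assumes I: "left_ideal I" "I \<noteq> {0}"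
  shows "(\<Sum>y\<in>I \<inter> left_socle. \<omega> y) = 0"
proof -
  obtain s :: 'a where s: "left_socle = left_principal s"
    using socle by blast
  obtain t where t: "I \<inter> left_socle = left_principal t"
    using left_ideal_of_principal_socle[OF s left_ideal_Int[OF I(1) left_ideal_left_socle]]
    by blast
  obtain L where L: "minimal_left_ideal L" "L \<subseteq> I"
    using minimal_left_ideal_exists[OF I] by blast
  then have "L \<subseteq> left_principal t"
    using minimal_left_ideal_subset_socle t by blast
  moreover have "0 \<in> L" "L \<noteq> {0}"
    using L(1) by (simp_all add: minimal_left_ideal_def left_ideal_def)
  ultimately have "left_principal t \<noteq> {0}"
    by blast
  then have "t \<noteq> 0"
    by (auto simp: left_principal_def)
  then show ?thesis
    using t sum_principal by simp
qed

text \<open>Cutting \<open>\<omega>\<close> off outside the socle does not change the properties that determine it, so by uniqueness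
  it does not change \<open>\<omega>\<close>.\<close>

lemma zero_off_socle:
  assumes "x \<notin> left_socle"
  shows "\<omega> x = 0"
proof -
  define f where "f y = (if y \<in> left_socle then \<omega> y else 0)" for y :: 'a
  have "f x = f 0 * \<omega> x"
  proof (rule multiple_of_\<omega>)
    fix x y :: 'a assume eq: "left_principal x = left_principal y"
    then have "x \<in> left_socle \<longleftrightarrow> y \<in> left_socle"
      using left_principal_subset_iff[OF left_ideal_left_socle] by metis
    then show "f x = f y"
      using same_principal[OF eq] by (simp add: f_def)
  next
    fix x :: 'a assume "x \<noteq> 0"
    then have "left_principal x \<noteq> {0}"
      using left_principal_self[of x] by auto
    then show "(\<Sum>y\<in>left_principal x. f y) = 0"
      using sum_socle_left_ideal[OF left_ideal_left_principal]
      by (simp add: f_def sum.inter_restrict)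
  qed
  moreover have "f 0 = 1"
    using left_ideal_left_socle[where 'a='a] at_zero by (simp add: f_def left_ideal_def)
  ultimately show ?thesis
    using assms by (simp add: f_def)
qed

lemma sum_left_ideal:
  assumes "left_ideal I" "I \<noteq> {0}"
  shows "(\<Sum>y\<in>I. \<omega> y) = 0"
proof -
  have "(\<Sum>y\<in>I. \<omega> y) = (\<Sum>y\<in>I \<inter> left_socle. \<omega> y)"
    by (rule sum.mono_neutral_right) (auto simp: zero_off_socle)
  then show ?thesis
    using sum_socle_left_ideal[OF assms] by simp
qed

text \<open>As a function of \<open>z\<close> the sum is constant on the generators of a principal left ideal, and its sums
  over \<open>R x\<close>, for \<open>x \<noteq> 0\<close>, are multiples of the sum of \<open>\<omega>\<close> over \<open>R x + I\<close>, which is zero. So it is a multiple of \<open>\<omega>\<close>, with the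
  factor given by its value at \<open>z = 0\<close>, which is zero.\<close>

lemma sum_coset:
  assumes I: "left_ideal I" "I \<noteq> {0}"
  shows "(\<Sum>a\<in>I. \<omega> (z + a)) = 0"
proof -
  define h where "h z = (\<Sum>a\<in>I. \<omega> (z + a))" for z
  have I0: "0 \<in> I" and Imult: "\<And>r a. a \<in> I \<Longrightarrow> r * a \<in> I"
    using I(1) by (auto simp: left_ideal_def)
  have "h z = h 0 * \<omega> z"
  proof (rule multiple_of_\<omega>)
    fix x y :: 'a assume "left_principal x = left_principal y"
    then obtain u v where uv: "v * u = 1" "u * v = 1" "y = u * x"
      by (rule same_left_principal_imp_associated)
    have cancel: "u * (v * a) = a" "v * (u * a) = a" for a
      using uv(1,2) by (metis mult.assoc mult_1)+
    have "h y = (\<Sum>a\<in>I. \<omega> (u * x + u * a))"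
      unfolding h_def uv(3)
      by (rule sum.reindex_bij_witness[where i = "\<lambda>a. u * a" and j = "\<lambda>a. v * a"])
         (auto simp: cancel Imult)
    also have "\<dots> = h x"
      unfolding h_def using unit_mult[OF uv(1)] by (simp add: distrib_left[symmetric])
    finally show "h x = h y" by simp
  next
    fix x :: 'a assume x: "x \<noteq> 0"
    let ?X = "left_principal x + I"
    have X: "left_ideal ?X"
      by (rule left_ideal_plus[OF left_ideal_left_principal I(1)])
    have "x \<in> ?X"
      using subset_plus_left_ideal[OF left_ideal_left_principal I(1)] left_principal_self by blast
    then have "?X \<noteq> {0}"
      using x by blast
    then have "(\<Sum>z\<in>?X. \<omega> z) = 0"
      using sum_left_ideal X by blast
    moreover have "0 \<in> left_principal x"
      using left_principal_mult[of 0 x] by simp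
    note sum_over_pairs[OF this I0 left_ideal_diff[OF left_ideal_left_principal]
        left_ideal_diff[OF I(1)], of \<omega> 1]
    ultimately show "(\<Sum>z\<in>left_principal x. h z) = 0"
      unfolding h_def by simp
  qed
  also have "h 0 = 0"
    using sum_left_ideal[OF I] by (simp add: h_def)
  finally show ?thesis by (simp add: h_def)
qed

text \<open>By uniqueness again: the sum of the left-hand side over \<open>a \<in> R x\<close> splits into sums of \<open>\<omega>\<close> over
  cosets of \<open>R x\<close>, and \<open>\<omega>\<close> is even, which gives the value at \<open>a = 0\<close>.\<close>

lemma convolution:
  "(\<Sum>r\<in>UNIV. \<omega> (a - r) * \<omega> r) = (\<Sum>r\<in>UNIV. (\<omega> r)\<^sup>2) * \<omega> a"
proof -
  define g where "g a = (\<Sum>r\<in>UNIV. \<omega> (a - r) * \<omega> r)" for a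
  have "g a = g 0 * \<omega> a"
  proof (rule multiple_of_\<omega>)
    fix x y :: 'a assume "left_principal x = left_principal y"
    then obtain u v where uv: "v * u = 1" "u * v = 1" "y = u * x"
      by (rule same_left_principal_imp_associated)
    have cancel: "u * (v * a) = a" "v * (u * a) = a" for a
      using uv(1,2) by (metis mult.assoc mult_1)+
    have "g y = (\<Sum>r\<in>UNIV. \<omega> (u * x - u * r) * \<omega> (u * r))"
      unfolding g_def uv(3)
      by (rule sum.reindex_bij_witness[where i = "\<lambda>a. u * a" and j = "\<lambda>a. v * a"])
         (auto simp: cancel)
    also have "\<dots> = g x"
      unfolding g_def using unit_mult[OF uv(1)] by (simp add: right_diff_distrib[symmetric])
    finally show "g x = g y" by simp
  next
    fix x :: 'a assume x: "x \<noteq> 0"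
    have "(\<Sum>y\<in>left_principal x. g y)
        = (\<Sum>r\<in>UNIV. (\<Sum>y\<in>left_principal x. \<omega> (- r + y)) * \<omega> r)"
      unfolding g_def by (subst sum.swap) (simp add: sum_distrib_right)
    also have "\<dots> = 0"
    proof -
      have "left_principal x \<noteq> {0}"
        using x left_principal_self[of x] by blast
      then show ?thesis
        using sum_coset[OF left_ideal_left_principal] by (simp del: uminus_add_conv_diff)
    qed
    finally show "(\<Sum>y\<in>left_principal x. g y) = 0" .
  qed
  also have "g 0 = (\<Sum>r\<in>UNIV. (\<omega> r)\<^sup>2)"
    by (simp add: g_def minus power2_eq_square)
  finally show ?thesis by (simp add: g_def)
qed

end

section \<open>Correlations of the coordinates of a code\<close>

lemma left_linear_code_diff:
  assumes "left_linear_code C" "x \<in> C" "y \<in> C"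
  shows "x - y \<in> C"
proof -
  have "x + (-1) *s y \<in> C"
    using assms unfolding left_linear_code_def by blast
  moreover have "x + (-1) *s y = x - y"
    by (simp add: vec_eq_iff)
  ultimately show ?thesis by simp
qed

context principal_mean_zero
begin

lemma sum_coordinate:
  fixes C :: "('a ^ 'n) set"
  assumes C: "left_linear_code C" and onto: "(\<lambda>c. c $ i) ` C = UNIV"
  shows "(\<Sum>c\<in>C. \<omega> (c $ i)) = 0"
proof -
  have "(\<Sum>c\<in>C. \<omega> (c $ i)) = real (card {c \<in> C. c $ i = 0}) * (\<Sum>a\<in>UNIV. \<omega> a)"
    using sum_over_additive_image[of C "\<lambda>c. c $ i" \<omega>] onto left_linear_code_diff[OF C] C
    by (simp add: left_linear_code_def)
  also have "(\<Sum>a\<in>UNIV. \<omega> a) = 0"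
  proof (rule sum_left_ideal)
    show "(UNIV :: 'a set) \<noteq> {0}"
      by (metis UNIV_I singletonD zero_neq_one)
  qed (simp add: left_ideal_def)
  finally show ?thesis by simp
qed

lemma coordinate_autocorrelation:
  fixes C :: "('a ^ 'n) set"
  assumes C: "left_linear_code C" and onto: "(\<lambda>c. c $ i) ` C = UNIV"
  shows "(\<Sum>y\<in>C. \<omega> (x $ i - y $ i) * \<omega> (y $ i))
    = real (card C) / real CARD('a) * (\<Sum>r\<in>UNIV. (\<omega> r)\<^sup>2) * \<omega> (x $ i)"
proof -
  note fibre = sum_over_additive_image[of C "\<lambda>c. c $ i", unfolded onto,
      OF finite _ left_linear_code_diff[OF C]]
  have 0: "0 \<in> C" using C by (simp add: left_linear_code_def)
  have "real (card C) = real (card {c \<in> C. c $ i = 0}) * real CARD('a)"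
    using fibre[of "\<lambda>_. 1"] 0 by simp
  then have "real (card {c \<in> C. c $ i = 0}) = real (card C) / real CARD('a)"
    by (simp add: field_simps)
  then show ?thesis
    using fibre[of "\<lambda>r. \<omega> (x $ i - r) * \<omega> r"] 0 by (simp add: convolution)
qed

text \<open>The sum does not change if \<open>y\<close> is translated by a codeword \<open>k\<close> with \<open>k\<^sub>j = 0\<close>. Averaging over all such
  \<open>k\<close> replaces the first factor by a mean of \<open>\<omega>\<close> over a coset of the left ideal of the entries \<open>k\<^sub>i\<close>,
  and this mean is zero.\<close>

lemma coordinate_crosscorrelation:
  fixes C :: "('a ^ 'n) set"
  assumes C: "left_linear_code C" and indep: "\<exists>c\<in>C. c $ j = 0 \<and> c $ i \<noteq> 0"
  shows "(\<Sum>y\<in>C. \<omega> (x $ i - y $ i) * \<omega> (y $ j)) = 0"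
proof -
  define K where "K = {c \<in> C. c $ j = 0}"
  define I where "I = (\<lambda>c. c $ i) ` K"
  let ?S = "\<Sum>y\<in>C. \<omega> (x $ i - y $ i) * \<omega> (y $ j)"
  have K: "left_linear_code K"
    using C by (auto simp: K_def left_linear_code_def)
  have I: "left_ideal I"
    unfolding left_ideal_def
  proof (intro conjI ballI allI)
    show "0 \<in> I"
      using K unfolding I_def left_linear_code_def by (intro image_eqI[of _ _ 0]) auto
  next
    fix a b assume "a \<in> I" "b \<in> I"
    then obtain c d where "c \<in> K" "d \<in> K" "a = c $ i" "b = d $ i"
      by (auto simp: I_def)
    then show "a + b \<in> I"
      using K unfolding I_def left_linear_code_def by (intro image_eqI[of _ _ "c + d"]) auto
  next
    fix r a assume "a \<in> I"
    then obtain c where "c \<in> K" "a = c $ i"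
      by (auto simp: I_def)
    then show "r * a \<in> I"
      using K unfolding I_def left_linear_code_def by (intro image_eqI[of _ _ "r *s c"]) auto
  qed
  have I_ne: "I \<noteq> {0}"
    using indep unfolding I_def K_def by blast
  have inner: "(\<Sum>k\<in>K. \<omega> (z - k $ i)) = 0" for z
  proof -
    have "(\<Sum>k\<in>K. \<omega> (z - k $ i))
        = real (card {k \<in> K. k $ i = 0}) * (\<Sum>a\<in>I. \<omega> (z - a))"
      unfolding I_def
      using sum_over_additive_image[of K "\<lambda>c. c $ i" "\<lambda>a. \<omega> (z - a)"]
        left_linear_code_diff[OF K] K by (simp add: left_linear_code_def)
    also have "(\<Sum>a\<in>I. \<omega> (z - a)) = (\<Sum>a\<in>I. \<omega> (- z + a))"
      by (rule sum.cong[OF refl]) (metis minus minus_diff_eq uminus_add_conv_diff)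
    also have "\<dots> = 0"
      by (rule sum_coset[OF I I_ne])
    finally show ?thesis by simp
  qed
  have translate: "?S = (\<Sum>y\<in>C. \<omega> (x $ i - y $ i - k $ i) * \<omega> (y $ j))" if "k \<in> K" for k
  proof -
    have k: "k \<in> C" "k $ j = 0"
      using that by (auto simp: K_def)
    show ?thesis
      by (rule sum.reindex_bij_witness[where i = "\<lambda>y. y + k" and j = "\<lambda>y. y - k"])
         (use k C left_linear_code_diff[OF C] in \<open>auto simp: left_linear_code_def algebra_simps\<close>)
  qed
  have "real (card K) * ?S = (\<Sum>k\<in>K. ?S)" by simp
  also have "\<dots> = (\<Sum>k\<in>K. \<Sum>y\<in>C. \<omega> (x $ i - y $ i - k $ i) * \<omega> (y $ j))"
    by (rule sum.cong[OF refl translate])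
  also have "\<dots> = (\<Sum>y\<in>C. (\<Sum>k\<in>K. \<omega> (x $ i - y $ i - k $ i)) * \<omega> (y $ j))"
    by (subst sum.swap) (simp add: sum_distrib_right)
  also have "\<dots> = 0"
    by (simp add: inner)
  finally have "card K = 0 \<or> ?S = 0" by simp
  moreover have "card K \<noteq> 0"
    using K by (auto simp: left_linear_code_def)
  ultimately show ?thesis by blast
qed

lemma code_convolution:
  fixes C :: "('a ^ 'n) set"
  assumes C: "left_linear_code C"
    and onto: "\<And>i. (\<lambda>c. c $ i) ` C = UNIV"
    and indep: "\<And>i j. i \<noteq> j \<Longrightarrow> \<exists>c\<in>C. c $ j = 0 \<and> c $ i \<noteq> 0"
  shows "(\<Sum>y\<in>C. (\<Sum>i\<in>UNIV. \<omega> ((x - y) $ i)) * (\<Sum>j\<in>UNIV. \<omega> (y $ j)))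
    = real (card C) / real CARD('a) * (\<Sum>r\<in>UNIV. (\<omega> r)\<^sup>2) * (\<Sum>i\<in>UNIV. \<omega> (x $ i))"
    (is "_ = ?\<kappa> * _")
proof -
  let ?c = "\<lambda>i j. \<Sum>y\<in>C. \<omega> (x $ i - y $ i) * \<omega> (y $ j)"
  have "(\<Sum>y\<in>C. (\<Sum>i\<in>UNIV. \<omega> ((x - y) $ i)) * (\<Sum>j\<in>UNIV. \<omega> (y $ j)))
      = (\<Sum>y\<in>C. \<Sum>i\<in>UNIV. \<Sum>j\<in>UNIV. \<omega> (x $ i - y $ i) * \<omega> (y $ j))"
    by (simp add: sum_product)
  also have "\<dots> = (\<Sum>i\<in>UNIV. \<Sum>y\<in>C. \<Sum>j\<in>UNIV. \<omega> (x $ i - y $ i) * \<omega> (y $ j))"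
    by (rule sum.swap)
  also have "\<dots> = (\<Sum>i\<in>UNIV. \<Sum>j\<in>UNIV. ?c i j)"
    by (rule sum.cong[OF refl sum.swap])
  also have "\<dots> = (\<Sum>i\<in>UNIV. ?\<kappa> * \<omega> (x $ i))"
  proof (rule sum.cong[OF refl])
    fix i
    have "(\<Sum>j\<in>UNIV. ?c i j) = (\<Sum>j\<in>UNIV. if j = i then ?c i i else 0)"
      by (rule sum.cong[OF refl]) (use coordinate_crosscorrelation[OF C indep] in auto)
    also have "\<dots> = ?c i i" by simp
    also have "\<dots> = ?\<kappa> * \<omega> (x $ i)"
      by (rule coordinate_autocorrelation[OF C onto])
    finally show "(\<Sum>j\<in>UNIV. ?c i j) = ?\<kappa> * \<omega> (x $ i)" .
  qed
  finally show ?thesis by (simp add: sum_distrib_left)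
qed

end

text \<open>Otherwise \<open>c\<^sub>i\<close> is a function of \<open>c\<^sub>j\<close> on the code. By linearity \<open>c\<^sub>i = c\<^sub>j r\<close>, where \<open>r\<close> is the entry
  \<open>d\<^sub>i\<close> of a codeword with \<open>d\<^sub>j = 1\<close>, and \<open>r\<close> is invertible because \<open>c\<^sub>i\<close> takes the value \<open>1\<close>. The columns
  \<open>i\<close> and \<open>j\<close> of the generator matrix then span the same right module.\<close>

lemma projective_regular_coordinates:
  fixes C :: "('a::{finite,ring_1} ^ 'n) set" and Y :: "'a ^ 'n ^ 'k"
  assumes C: "left_linear_code C" and reg: "regular_code Y C" and proj: "projective_code Y C"
    and "i \<noteq> j"
  shows "\<exists>c\<in>C. c $ j = 0 \<and> c $ i \<noteq> 0"
proof (rule ccontr)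
  assume "\<not> ?thesis"
  then have dep: "c $ i = 0" if "c \<in> C" "c $ j = 0" for c
    using that by blast
  have Y: "generator_matrix Y C"
    using reg by (simp add: regular_code_def)
  have onto: "(\<lambda>c. c $ k) ` C = UNIV" for k
    using reg regular_code_iff[OF Y] by blast
  obtain d where d: "d \<in> C" "d $ j = 1"
    using onto[of j] by (metis (mono_tags, lifting) UNIV_I imageE)
  define r where "r = d $ i"
  have r: "c $ i = c $ j * r" if "c \<in> C" for c
  proof -
    have "c - (c $ j) *s d \<in> C"
      using left_linear_code_diff[OF C that] C d(1) by (simp add: left_linear_code_def)
    from dep[OF this] show ?thesis
      using d(2) by (simp add: r_def)
  qed
  obtain e where e: "e \<in> C" "e $ i = 1"
    using onto[of i] by (metis (mono_tags, lifting) UNIV_I imageE)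
  have inv: "r * (e $ j) = 1"
    using r[OF e(1)] e(2) finite_ring_left_inverse_imp_right_inverse[of "e $ j" r] by simp
  have "c $ j = c $ i * (e $ j)" if "c \<in> C" for c
    using r[OF that] inv by (simp add: mult.assoc)
  then show False
    using proj \<open>i \<noteq> j\<close> r unfolding projective_code_iff[OF Y] by blast
qed

section \<open>Two-valued weights on finite abelian groups\<close>

text \<open>With \<open>\<Omega> = n - wt\<close> and \<open>A\<close> the indicator of weight \<open>w1\<close>, two-valuedness reads
  \<open>\<Omega> = (n - w2) + w2 \<delta>\<^sub>0 + (w2 - w1) A\<close>. Inserting this for one factor of \<open>\<Omega> * \<Omega> = \<kappa> \<Omega>\<close> gives
  \<open>\<Omega> * A = \<theta> \<Omega>\<close>, and evaluation at \<open>0\<close> gives \<open>\<theta> = K (1 - w1/n)\<close>. Inserting it for the remaining \<open>\<Omega>\<close>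
  expresses \<open>(A * A)(x)\<close>, the number of common neighbours of two vertices with difference \<open>x\<close>, by the
  weight of \<open>x\<close>.\<close>

lemma two_valued_weight_strongly_regular:
  fixes C :: "'b::ab_group_add set" and wt :: "'b \<Rightarrow> real" and n w1 w2 \<kappa> :: real
  assumes fin: "finite C" and C0: "0 \<in> C"
    and diff: "\<And>x y. x \<in> C \<Longrightarrow> y \<in> C \<Longrightarrow> x - y \<in> C"
    and wt0: "wt 0 = 0" and wt_minus: "\<And>x. wt (- x) = wt x"
    and two: "\<And>x. x \<in> C \<Longrightarrow> x \<noteq> 0 \<Longrightarrow> wt x = w1 \<or> wt x = w2"
    and attained: "w1 \<in> wt ` C" "w2 \<in> wt ` C"
    and ne: "w1 \<noteq> w2" "w1 \<noteq> 0" "w2 \<noteq> 0" "n \<noteq> 0"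
    and total: "(\<Sum>x\<in>C. n - wt x) = 0"
    and conv: "\<And>x. x \<in> C \<Longrightarrow> (\<Sum>y\<in>C. (n - wt (x - y)) * (n - wt y)) = \<kappa> * (n - wt x)"
  shows "\<exists>N K l m :: nat.
    strongly_regular C {{x, y} | x y. x \<in> C \<and> y \<in> C \<and> wt (x - y) = w1} N K l m \<and>
    N = card C \<and>
    real K = ((n - w2) * real (card C) + w2) / (w1 - w2) \<and>
    real l = (n * real K * (1 - (1 - w1 / n)\<^sup>2) + w2 * (1 - real K)) / (w1 - w2) \<and>
    real m = (n * real K * (1 - (1 - w1 / n) * (1 - w2 / n)) - w2 * real K) / (w1 - w2)"
proof -
  define E where "E = {{x, y} | x y. x \<in> C \<and> y \<in> C \<and> wt (x - y) = w1}"
  define \<Omega> where "\<Omega> x = n - wt x" for x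
  define A where "A x = (if wt x = w1 then 1 else 0 :: real)" for x
  define K where "K = card {x \<in> C. wt x = w1}"
  define P where "P x = card {y \<in> C. wt (x - y) = w1 \<and> wt y = w1}" for x
  have plus: "x + y \<in> C" if "x \<in> C" "y \<in> C" for x y
    using diff[OF that(1) diff[OF C0 that(2)]] by simp
  have \<Omega>_expand: "\<Omega> x = (n - w2) + (if x = 0 then w2 else 0) + (w2 - w1) * A x" if "x \<in> C" for x
    using two[OF that] wt0 ne by (auto simp: \<Omega>_def A_def)
  have sumA: "(\<Sum>x\<in>C. A x) = real K"
    using fin by (simp add: A_def K_def sum.If_cases Int_def)
  have sum0: "(\<Sum>x\<in>C. \<Omega> x) = 0"
    using total by (simp add: \<Omega>_def)
  have "0 = (\<Sum>x\<in>C. (n - w2) + (if x = 0 then w2 else 0) + (w2 - w1) * A x)"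
    using sum0 \<Omega>_expand by simp
  also have "\<dots> = (n - w2) * real (card C) + w2 + (w2 - w1) * real K"
    using fin C0 by (simp add: sum.distrib sum_distrib_left[symmetric] sumA)
  finally have K_eq: "real K = ((n - w2) * real (card C) + w2) / (w1 - w2)"
    using ne by (simp add: field_simps)
  have sum0': "(\<Sum>y\<in>C. \<Omega> (x - y)) = 0" if "x \<in> C" for x
  proof -
    have "(\<Sum>y\<in>C. \<Omega> (x - y)) = (\<Sum>y\<in>C. \<Omega> y)"
      by (rule sum.reindex_bij_witness[where i = "\<lambda>y. x - y" and j = "\<lambda>y. x - y"])
         (use diff that in auto)
    then show ?thesis using sum0 by simp
  qed
  define \<theta> where "\<theta> = (\<kappa> - w2) / (w2 - w1)"
  have eigen: "(\<Sum>y\<in>C. \<Omega> (x - y) * A y) = \<theta> * \<Omega> x" if x: "x \<in> C" for x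
  proof -
    have "\<kappa> * \<Omega> x = (\<Sum>y\<in>C. \<Omega> (x - y) * \<Omega> y)"
      using conv[OF x] by (simp add: \<Omega>_def)
    also have "\<dots> = (\<Sum>y\<in>C. (n - w2) * \<Omega> (x - y) + (if y = 0 then w2 * \<Omega> x else 0)
        + (w2 - w1) * (\<Omega> (x - y) * A y))"
    proof (rule sum.cong[OF refl])
      fix y assume "y \<in> C"
      then have "\<Omega> (x - y) * \<Omega> y
          = \<Omega> (x - y) * ((n - w2) + (if y = 0 then w2 else 0) + (w2 - w1) * A y)"
        by (metis \<Omega>_expand)
      then show "\<Omega> (x - y) * \<Omega> y = (n - w2) * \<Omega> (x - y) + (if y = 0 then w2 * \<Omega> x else 0)
          + (w2 - w1) * (\<Omega> (x - y) * A y)"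
        by (cases "y = 0") (simp_all add: algebra_simps)
    qed
    also have "\<dots> = w2 * \<Omega> x + (w2 - w1) * (\<Sum>y\<in>C. \<Omega> (x - y) * A y)"
      using fin C0 sum0'[OF x] by (simp add: sum.distrib sum_distrib_left[symmetric])
    finally show ?thesis
      using ne(1) by (simp add: \<theta>_def field_simps)
  qed
  have "\<theta> * n = (\<Sum>y\<in>C. \<Omega> (0 - y) * A y)"
    using eigen[OF C0] wt0 by (simp add: \<Omega>_def)
  also have "\<dots> = (\<Sum>y\<in>C. (n - w1) * A y)"
    by (rule sum.cong[OF refl]) (auto simp: \<Omega>_def A_def wt_minus)
  also have "\<dots> = (n - w1) * real K"
    by (simp add: sum_distrib_left[symmetric] sumA)
  finally have \<theta>: "\<theta> = real K * (1 - w1 / n)"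
    using ne(4) by (simp add: field_simps)
  have sumP: "(\<Sum>y\<in>C. A (x - y) * A y) = real (P x)" for x
  proof -
    have "(\<Sum>y\<in>C. A (x - y) * A y) = (\<Sum>y\<in>C. if wt (x - y) = w1 \<and> wt y = w1 then 1 else 0)"
      by (rule sum.cong[OF refl]) (auto simp: A_def)
    then show ?thesis
      using fin by (simp add: P_def sum.If_cases Int_def)
  qed
  have P_eq: "(n - w2) * real K + w2 * A x + (w2 - w1) * real (P x)
      = real K * (1 - w1 / n) * \<Omega> x" if x: "x \<in> C" for x
  proof -
    have "real K * (1 - w1 / n) * \<Omega> x = (\<Sum>y\<in>C. \<Omega> (x - y) * A y)"
      using eigen[OF x] \<theta> by simp
    also have "\<dots> = (\<Sum>y\<in>C. (n - w2) * A y + (if y = x then w2 * A x else 0)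
        + (w2 - w1) * (A (x - y) * A y))"
    proof (rule sum.cong[OF refl])
      fix y assume y: "y \<in> C"
      show "\<Omega> (x - y) * A y = (n - w2) * A y + (if y = x then w2 * A x else 0)
          + (w2 - w1) * (A (x - y) * A y)"
        unfolding \<Omega>_expand[OF diff[OF x y]] by (cases "y = x") (simp_all add: algebra_simps)
    qed
    also have "\<dots> = (n - w2) * real K + w2 * A x + (w2 - w1) * real (P x)"
      using fin x by (simp add: sum.distrib sum_distrib_left[symmetric] sumA sumP)
    finally show ?thesis by simp
  qed
  obtain c1 where c1: "c1 \<in> C" "wt c1 = w1" using attained(1) by auto
  obtain c2 where c2: "c2 \<in> C" "wt c2 = w2" using attained(2) by auto
  have l: "real (P x) = (n * real K * (1 - (1 - w1 / n)\<^sup>2) + w2 * (1 - real K)) / (w1 - w2)"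
    if "x \<in> C" "wt x = w1" for x
  proof -
    define q where "q = 1 - w1 / n"
    have "\<Omega> x = n * q"
      using that(2) ne by (simp add: \<Omega>_def q_def field_simps)
    then have "(n - w2) * real K + w2 + (w2 - w1) * real (P x) = real K * q * (n * q)"
      using P_eq[OF that(1)] that(2) by (simp add: A_def q_def)
    then have "real (P x) * (w1 - w2) = n * real K * (1 - q\<^sup>2) + w2 * (1 - real K)"
      by (simp add: algebra_simps power2_eq_square)
    then show ?thesis
      using ne(1) by (simp add: q_def eq_divide_eq)
  qed
  have m: "real (P x) = (n * real K * (1 - (1 - w1 / n) * (1 - w2 / n)) - w2 * real K) / (w1 - w2)"
    if "x \<in> C" "wt x = w2" for x
  proof -
    define q where "q = 1 - w1 / n"
    define p where "p = 1 - w2 / n"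
    have "\<Omega> x = n * p"
      using that(2) ne by (simp add: \<Omega>_def p_def field_simps)
    then have "(n - w2) * real K + (w2 - w1) * real (P x) = real K * q * (n * p)"
      using P_eq[OF that(1)] that(2) ne(1) by (simp add: A_def q_def)
    then have "real (P x) * (w1 - w2) = n * real K * (1 - q * p) - w2 * real K"
      by (simp add: algebra_simps)
    then show ?thesis
      using ne(1) by (simp add: q_def p_def eq_divide_eq)
  qed
  have wt_sym: "wt (x - y) = wt (y - x)" for x y
    using wt_minus[of "x - y"] by simp
  have edge: "{x, y} \<in> E \<longleftrightarrow> x \<in> C \<and> y \<in> C \<and> wt (x - y) = w1" for x y
    unfolding E_def using wt_sym by (auto simp: doubleton_eq_iff)
  have nbrs: "neighbours C E x = {y \<in> C. wt (x - y) = w1}" if "x \<in> C" for x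
    using that by (auto simp: neighbours_def edge)
  have deg: "card (neighbours C E x) = K" if x: "x \<in> C" for x
  proof -
    have "bij_betw (\<lambda>y. x - y) {y \<in> C. wt (x - y) = w1} {y \<in> C. wt y = w1}"
      by (rule bij_betw_byWitness[where f' = "\<lambda>y. x - y"]) (use diff x in auto)
    from bij_betw_same_card[OF this] show ?thesis
      by (simp add: K_def nbrs[OF x])
  qed
  have common: "card (neighbours C E x \<inter> neighbours C E y) = P (x - y)"
    if x: "x \<in> C" and y: "y \<in> C" for x y
  proof -
    have bij: "bij_betw (\<lambda>z. z - y) {z \<in> C. wt (x - z) = w1 \<and> wt (z - y) = w1}
        {v \<in> C. wt (x - y - v) = w1 \<and> wt v = w1}"
      by (rule bij_betw_byWitness[where f' = "\<lambda>v. v + y"])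
         (use diff plus x y in \<open>auto simp: algebra_simps\<close>)
    have "neighbours C E x \<inter> neighbours C E y
        = {z \<in> C. wt (x - z) = w1 \<and> wt (z - y) = w1}"
      unfolding nbrs[OF x] nbrs[OF y] wt_sym[of y] by blast
    then show ?thesis
      unfolding P_def using bij_betw_same_card[OF bij] by argo
  qed
  have "simple_graph C E"
    unfolding simple_graph_def
  proof (intro conjI ballI fin)
    fix e assume "e \<in> E"
    then obtain x y where xy: "x \<in> C" "y \<in> C" "wt (x - y) = w1" "e = {x, y}"
      unfolding E_def by blast
    then have "x \<noteq> y"
      using wt0 ne(2) by auto
    with xy show "\<exists>x\<in>C. \<exists>y\<in>C. x \<noteq> y \<and> e = {x, y}"
      by blast
  qed
  moreover have "E \<noteq> {}"
    using edge[of c1 0] c1 C0 by auto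
  moreover have "\<exists>x\<in>C. \<exists>y\<in>C. x \<noteq> y \<and> {x, y} \<notin> E"
  proof (intro bexI conjI)
    show "c2 \<noteq> 0" using c2 wt0 ne(3) by auto
    show "{c2, 0} \<notin> E" using c2 ne(1) by (simp add: edge)
  qed (use c2 C0 in auto)
  moreover have "P (x - y) = P c1" if "x \<in> C" "y \<in> C" "{x, y} \<in> E" for x y
  proof -
    have "real (P (x - y)) = real (P c1)"
      using l[OF c1] l[OF diff] that by (simp add: edge)
    then show ?thesis by simp
  qed
  moreover have "P (x - y) = P c2" if "x \<in> C" "y \<in> C" "x \<noteq> y" "{x, y} \<notin> E" for x y
  proof -
    have "wt (x - y) = w2"
      using two[OF diff, of x y] that by (auto simp: edge)
    then have "real (P (x - y)) = real (P c2)"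
      using m[OF c2] m[OF diff] that by simp
    then show ?thesis by simp
  qed
  ultimately have "strongly_regular C E (card C) K (P c1) (P c2)"
    unfolding strongly_regular_def using deg common by auto
  then show ?thesis
    unfolding E_def using K_eq l[OF c1] m[OF c2] by blast
qed

section \<open>The graph of a two-weight code\<close>

theorem theorem5p5:
  fixes w_hom :: "'a::{finite,ring_1} \<Rightarrow> real"
    and C :: "('a ^ 'n) set"
    and Y :: "'a ^ 'n ^ 'k"
    and w1 w2 n :: real
  assumes "frobenius_ring TYPE('a)"
    and "normalized_homogeneous_weight w_hom"
    and "two_weight_code w_hom C w1 w2"
    and "regular_code Y C"
    and "projective_code Y C"
    and n_def: "n = real CARD('n)"
  shows "\<exists>N K l m :: nat.
    strongly_regular C (code_graph_edges w_hom C w1) N K l m \<and>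
    N = card C \<and>
    real K = ((n - w2) * real (card C) + w2) / (w1 - w2) \<and>
    real l = (n * real K * (1 - (1 - w1 / n)\<^sup>2) + w2 * (1 - real K)) / (w1 - w2) \<and>
    real m = (n * real K * (1 - (1 - w1 / n) * (1 - w2 / n)) - w2 * real K) / (w1 - w2)"
proof -
  define \<omega> where "\<omega> x = 1 - w_hom x" for x
  have w_zero: "w_hom 0 = 0"
    and w_same: "\<And>x y. left_principal x = left_principal y \<Longrightarrow> w_hom x = w_hom y"
    and w_sum: "\<And>x. x \<noteq> 0 \<Longrightarrow>
      (\<Sum>y\<in>left_principal x. w_hom y) = 1 * real (card (left_principal x))"
    using assms(2) unfolding normalized_homogeneous_weight_def homogeneous_weight_def by blast+
  interpret principal_mean_zero \<omega>
  proof
    show "\<omega> 0 = 1"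
      by (simp add: \<omega>_def w_zero)
    show "\<omega> x = \<omega> y" if "left_principal x = left_principal y" for x y
      unfolding \<omega>_def w_same[OF that] ..
    show "(\<Sum>y\<in>left_principal x. \<omega> y) = 0" if "x \<noteq> 0" for x
      using w_sum[OF that] by (simp add: \<omega>_def sum_subtractf)
    show "\<exists>s :: 'a. left_socle = left_principal s"
      by (rule frobenius_ring_socle_principal[OF assms(1)])
  qed
  have C: "left_linear_code C" and "w1 \<noteq> w2"
    and proper: "\<And>c. c \<in> C \<Longrightarrow> c \<noteq> 0 \<Longrightarrow> vec_weight w_hom c > 0"
    and weights: "vec_weight w_hom ` C - {0} = {w1, w2}"
    using assms(3) by (auto simp: two_weight_code_def proper_code_def)
  have onto: "(\<lambda>c. c $ i) ` C = UNIV" for i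
    using assms(4) regular_code_iff unfolding regular_code_def by blast
  have n_minus: "n - vec_weight w_hom c = (\<Sum>i\<in>UNIV. \<omega> (c $ i))" for c :: "'a ^ 'n"
    by (simp add: n_def vec_weight_def \<omega>_def sum_subtractf)
  have w_hom: "w_hom x = 1 - \<omega> x" for x
    by (simp add: \<omega>_def)
  show ?thesis
    unfolding code_graph_edges_def
  proof (rule two_valued_weight_strongly_regular)
    show "0 \<in> C" using C by (simp add: left_linear_code_def)
    show "x - y \<in> C" if "x \<in> C" "y \<in> C" for x y
      using left_linear_code_diff[OF C that] .
    show "vec_weight w_hom (0 :: 'a ^ 'n) = 0"
      by (simp add: vec_weight_def w_hom at_zero)
    show "vec_weight w_hom (- x) = vec_weight w_hom x" for x :: "'a ^ 'n"
      by (simp add: vec_weight_def w_hom minus)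
    show "vec_weight w_hom x = w1 \<or> vec_weight w_hom x = w2" if "x \<in> C" "x \<noteq> 0" for x
      using proper[OF that] weights that(1) by force
    show "w1 \<in> vec_weight w_hom ` C" "w2 \<in> vec_weight w_hom ` C" "w1 \<noteq> 0" "w2 \<noteq> 0"
      using weights by blast+
    show "(\<Sum>x\<in>C. n - vec_weight w_hom x) = 0"
      unfolding n_minus by (subst sum.swap) (simp add: sum_coordinate[OF C onto])
    show "(\<Sum>y\<in>C. (n - vec_weight w_hom (x - y)) * (n - vec_weight w_hom y))
        = real (card C) / real CARD('a) * (\<Sum>r\<in>UNIV. (\<omega> r)\<^sup>2) * (n - vec_weight w_hom x)" for x
      unfolding n_minus
      by (rule code_convolution[OF C onto
            projective_regular_coordinates[OF C assms(4,5)]])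
  qed (use \<open>w1 \<noteq> w2\<close> in \<open>simp_all add: n_def\<close>)
qed

end
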